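(* Let $\mathcal{S}=(H;E_1,E_2,E_3)$ be a system of three subspaces in a Hilbert space $H$. Then the following are equivalent: (1) The linear sums $(E_i\vee E_j)+E_k$ and $(E_i\cap E_j)+E_k$ are closed for all $i,j,k\in\{1,2,3\}$ with $i\neq j\neq k\neq i$. (2) $\mathcal{S}$ has a Brenner type decomposition.
   Context: Hilbert spaces are complex; "subspace" means closed linear subspace; $\oplus$ is the orthogonal direct sum. For subspaces $A,B$ of $H$: $A+B$ is the linear sum, $A\vee B:=\overline{A+B}$, $A\wedge B:=A\cap B$. A system of three subspaces $(H;E_1,E_2,E_3)$ is a Hilbert space $H$ with three closed subspaces $E_1,E_2,E_3$. Two systems $(H;E_1,E_2,E_3)$ and $(K;F_1,F_2,F_3)$ are isomorphic if there is a bounded bijective linear operator $\varphi:H\to K$ (with bounded inverse) such that $\varphi(E_i)=F_i$ for $i=1,2,3$. A system $(Q;Q_1,Q_2,Q_3)$ forms a double triangle if $Q_i\vee Q_j=Q$ and $Q_i\wedge Q_j=0$ for all $i\neq j$ in $\{1,2,3\}$, and each $Q_i\neq Q$, $Q_i\neq 0$. A system $\mathcal S=(H;E_1,E_2,E_3)$ has a Brenner type decomposition if it is isomorphic to a system $\mathcal T=(H;F_1,F_2,F_3)$ for which there exist (possibly zero) closed subspaces $S,N_1,N_2,N_3,M_1,M_2,M_3,Q,L$ of $H$ and closed subspaces $Q_1,Q_2,Q_3$ of $Q$ such that $(Q;Q_1,Q_2,Q_3)$ forms a double triangle or $Q=0$, and $H=S\oplus N_1\oplus N_2\oplus N_3\oplus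 M_1\oplus M_2\oplus M_3\oplus Q\oplus L$, $F_1=S\oplus N_2\oplus N_3\oplus M_1\oplus Q_1$, $F_2=S\oplus N_1\oplus N_3\oplus M_2\oplus Q_2$, $F_3=S\oplus N_1\oplus N_2\oplus M_3\oplus Q_3$. *)

theory Defs
  imports "HOL-Analysis.Analysis" "HOL-Library.Set_Algebras"
begin

section \<open>Complex Hilbert spaces\<close>

text \<open>
  A complex Hilbert space is a complete real inner product space (whose norm, topology and
  metric come from the library) carrying a complex scalar multiplication that extends the real
  one and a sesquilinear form whose real part is the real inner product. The form is linear in
  its second argument. Positive definiteness of \<open>cinner\<close> and \<open>norm x = sqrt (Re (cinner x x))\<close>
  follow from the corresponding axioms of \<^class>\<open>real_inner\<close>. The zero space is allowed.
\<close>

class complex_hilbert = real_inner + complete_space +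
  fixes scaleC :: "complex \<Rightarrow> 'a \<Rightarrow> 'a" (infixr "*\<^sub>C" 75)
    and cinner :: "'a \<Rightarrow> 'a \<Rightarrow> complex"
  assumes scaleC_add_right: "c *\<^sub>C (x + y) = c *\<^sub>C x + c *\<^sub>C y"
    and scaleC_add_left: "(c + d) *\<^sub>C x = c *\<^sub>C x + d *\<^sub>C x"
    and scaleC_scaleC: "c *\<^sub>C d *\<^sub>C x = (c * d) *\<^sub>C x"
    and scaleR_scaleC: "r *\<^sub>R x = complex_of_real r *\<^sub>C x"
    and cinner_commute: "cinner x y = cnj (cinner y x)"
    and cinner_add_right: "cinner x (y + z) = cinner x y + cinner x z"
    and cinner_scaleC_right: "cinner x (c *\<^sub>C y) = c * cinner x y"
    and inner_cinner: "x \<bullet> y = Re (cinner x y)"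

global_interpretation complex_vector:
  vector_space "scaleC :: complex \<Rightarrow> 'a \<Rightarrow> 'a::complex_hilbert"
proof
  fix c d :: complex and x y :: 'a
  show "c *\<^sub>C (x + y) = c *\<^sub>C x + c *\<^sub>C y" by (rule scaleC_add_right)
  show "(c + d) *\<^sub>C x = c *\<^sub>C x + d *\<^sub>C x" by (rule scaleC_add_left)
  show "c *\<^sub>C d *\<^sub>C x = (c * d) *\<^sub>C x" by (rule scaleC_scaleC)
  show "1 *\<^sub>C x = x" using scaleR_scaleC[of 1 x] by simp
qed

lemma cinner_self: "cinner x x = complex_of_real ((norm x)\<^sup>2)"
  for x :: "'a::complex_hilbert"
proof -
  have "Im (cinner x x) = 0"
    using cinner_commute[of x x] by (metis cnj.simps(2) equal_neg_zero)
  moreover have "Re (cinner x x) = (norm x)\<^sup>2"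
    using inner_cinner[of x x] by (simp add: dot_square_norm)
  ultimately show ?thesis by (simp add: complex_eq_iff)
qed

instantiation complex :: complex_hilbert
begin

definition scaleC_complex :: "complex \<Rightarrow> complex \<Rightarrow> complex"
  where "scaleC_complex c x = c * x"

definition cinner_complex :: "complex \<Rightarrow> complex \<Rightarrow> complex"
  where "cinner_complex x y = cnj x * y"

instance
  by standard
    (auto simp: scaleC_complex_def cinner_complex_def algebra_simps scaleR_conv_of_real
       inner_complex_def)

end

definition closed_csubspace :: "'a::complex_hilbert set \<Rightarrow> bool"
  where "closed_csubspace A \<longleftrightarrow> complex_vector.subspace A \<and> closed A"

definition bounded_clinear :: "('a::complex_hilbert \<Rightarrow> 'b::complex_hilbert) \<Rightarrow> bool"
  where "bounded_clinear f \<longleftrightarrow>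
    Vector_Spaces.linear scaleC scaleC f \<and> (\<exists>B. \<forall>x. norm (f x) \<le> B * norm x)"

definition corthogonal_sets :: "'a::complex_hilbert set \<Rightarrow> 'a set \<Rightarrow> bool"
  where "corthogonal_sets A B \<longleftrightarrow> (\<forall>x\<in>A. \<forall>y\<in>B. cinner x y = 0)"

text \<open>
  \<open>A + B\<close> for sets is the elementwise sum of \<^theory>\<open>HOL-Library.Set_Algebras\<close>, so that
  \<open>sum_list Vs\<close> is the linear sum of the list \<open>Vs\<close> of subspaces (\<open>{0}\<close> for the empty list);
  \<open>sorted_wrt\<close> states the relation for all pairs of positions \<open>i < j\<close>.
\<close>

definition is_orth_dsum :: "'a::complex_hilbert set \<Rightarrow> 'a set list \<Rightarrow> bool"
  where "is_orth_dsum V Vs \<longleftrightarrow> sorted_wrt corthogonal_sets Vs \<and> V = sum_list Vs"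

definition join :: "'a::complex_hilbert set \<Rightarrow> 'a set \<Rightarrow> 'a set" (infixl "\<or>\<^sub>H" 65)
  where "A \<or>\<^sub>H B = closure (A + B)"


section \<open>Systems of three subspaces\<close>

text \<open>
  A triple of subspaces is a family indexed by \<open>nat\<close> of which only the members \<open>1, 2, 3\<close> matter;
  the ambient Hilbert space is the whole type.
\<close>

definition three_system :: "(nat \<Rightarrow> 'a::complex_hilbert set) \<Rightarrow> bool"
  where "three_system E \<longleftrightarrow> (\<forall>i\<in>{1,2,3}. closed_csubspace (E i))"

definition isomorphic_systems ::
    "(nat \<Rightarrow> 'a::complex_hilbert set) \<Rightarrow> (nat \<Rightarrow> 'b::complex_hilbert set) \<Rightarrow> bool"
  where "isomorphic_systems E F \<longleftrightarrow>
    (\<exists>\<phi>. bounded_clinear \<phi> \<and> bij \<phi> \<and> bounded_clinear (inv \<phi>) \<and>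
         (\<forall>i\<in>{1,2,3}. \<phi> ` E i = F i))"

text \<open>
  Here the ambient Hilbert space \<open>Q\<close> is itself a closed subspace of the type, so closures
  taken in the type and in \<open>Q\<close> agree.
\<close>

definition double_triangle :: "'a::complex_hilbert set \<Rightarrow> (nat \<Rightarrow> 'a set) \<Rightarrow> bool"
  where "double_triangle Q Qs \<longleftrightarrow>
    closed_csubspace Q \<and>
    (\<forall>i\<in>{1,2,3}. closed_csubspace (Qs i) \<and> Qs i \<subseteq> Q \<and> Qs i \<noteq> Q \<and> Qs i \<noteq> {0}) \<and>
    (\<forall>i\<in>{1,2,3}. \<forall>j\<in>{1,2,3}. i \<noteq> j \<longrightarrow> Qs i \<or>\<^sub>H Qs j = Q \<and> Qs i \<inter> Qs j = {0})"

definition has_brenner_decomposition :: "(nat \<Rightarrow> 'a::complex_hilbert set) \<Rightarrow> bool"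
  where "has_brenner_decomposition E \<longleftrightarrow>
    (\<exists>F :: nat \<Rightarrow> 'a set. three_system F \<and> isomorphic_systems E F \<and>
      (\<exists>(S :: 'a set) (N :: nat \<Rightarrow> 'a set) (M :: nat \<Rightarrow> 'a set) (Q :: 'a set) (L :: 'a set)
        (Qs :: nat \<Rightarrow> 'a set).
        closed_csubspace S \<and> closed_csubspace Q \<and> closed_csubspace L \<and>
        (\<forall>i\<in>{1,2,3}. closed_csubspace (N i) \<and> closed_csubspace (M i) \<and>
                      closed_csubspace (Qs i) \<and> Qs i \<subseteq> Q) \<and>
        (double_triangle Q Qs \<or> Q = {0}) \<and>
        is_orth_dsum UNIV [S, N 1, N 2, N 3, M 1, M 2, M 3, Q, L] \<and>
        is_orth_dsum (F 1) [S, N 2, N 3, M 1, Qs 1] \<and>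
        is_orth_dsum (F 2) [S, N 1, N 3, M 2, Qs 2] \<and>
        is_orth_dsum (F 3) [S, N 1, N 2, M 3, Qs 3]))"

end

theory Submission
  imports Defs
begin

text \<open>
  Write \<open>A, B, C\<close> for the three subspaces.

  From a decomposition to closed sums: with respect to an orthogonal decomposition, sums, closures
  and intersections of subspaces that split along the summands are formed summand by summand
  (\<open>orth_plus_inter\<close>, \<open>closure_orth_plus\<close>). In the summand \<open>Q\<close> the join of two of the \<open>Q\<^sub>i\<close> is
  all of \<open>Q\<close> and their meet is zero, so both sums in question are orthogonal sums of closed
  subspaces, hence closed, and a linear homeomorphism carries closedness back to the given system.

  From closed sums to a decomposition, the point is to split off closed summands one at a time.
  Take for \<open>M\<^sub>1\<close> the orthogonal complement of \<open>A \<inter> (B \<or> C)\<close> in \<open>A\<close>. Then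
  \<open>M\<^sub>1 + (B \<or> C) = A + (B \<or> C)\<close> is closed and the sum on the left is direct. As \<open>M\<^sub>2 \<subseteq> B\<close> lies in
  \<open>B \<or> C\<close>, the modular law splits \<open>M\<^sub>2\<close> off from \<open>B \<or> C\<close> in turn, and then \<open>M\<^sub>3\<close>; what remains is
  \<open>K = (B \<or> C) \<inter> (A \<or> C) \<inter> (A \<or> B)\<close>. The second step is dual: \<open>N\<^sub>1\<close> is a complement of
  \<open>A \<inter> B \<inter> C\<close> in \<open>B \<inter> C\<close>, and closedness of \<open>(B \<inter> C) + A\<close> makes it possible to enlarge
  \<open>A \<inter> K\<close> to a closed complement \<open>P\<^sub>1\<close> of \<open>N\<^sub>1\<close> in \<open>K\<close>. Since \<open>N\<^sub>i\<close> lies in the other two \<open>P\<^sub>j\<close>, the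
  modular law again splits off all three, leaving, with \<open>S = A \<inter> B \<inter> C\<close>, \<open>P\<^sub>1 \<inter> P\<^sub>2 \<inter> P\<^sub>3 = S \<oplus> Q\<close>
  (\<open>brenner_summands_exist\<close>).

  The sum obtained in this way is topologically direct but in general not orthogonal. It becomes orthogonal
  under a linear homeomorphism (\<open>orthogonalize_top_direct\<close>), a Gram-Schmidt process for subspaces
  that needs only the boundedness of the projections belonging to a direct sum of closed subspaces,
  that is, the closed graph theorem. In the orthogonal picture the density of \<open>Q\<^sub>i + Q\<^sub>j\<close> in
  \<open>Q\<close> follows by comparing components in \<open>Q\<close> (\<open>Q_le_join\<close>).
\<close>

section \<open>The closed graph theorem\<close>

instance complex_hilbert \<subseteq> banach ..

text \<open>
  The Baire category theorem in the form used for the closed graph theorem.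
\<close>

lemma closed_cover_has_interior:
  fixes T :: "nat \<Rightarrow> 'a::complete_space set"
  assumes "\<And>n. closed (T n)" and "(\<Union>n. T n) = UNIV"
  obtains n where "interior (T n) \<noteq> {}"
proof (rule ccontr)
  assume "\<not> thesis"
  then have "\<And>n. interior (T n) = {}"
    using that by blast
  then have "euclidean interior_of \<Union>(range T) = {}"
    by (intro Baire_category_alt) (use assms completely_metrizable_space_euclidean in auto)
  then show False
    using assms(2) by simp
qed

text \<open>
  By Baire, the closure of some set where \<open>norm (f x) \<le> n\<close> contains a ball, and by symmetry and
  convexity a ball about the origin. After rescaling, every \<open>x\<close> is approximated to any accuracy
  by points \<open>y\<close> with \<open>norm (f y) \<le> K * norm x\<close>. Approximating \<open>x\<close>, then the error, and so on,
  writes \<open>x\<close> as a series whose image series converges absolutely with sum at most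
  \<open>2 * K * norm x\<close> in norm; the closed graph identifies that sum with \<open>f x\<close>.
\<close>

lemma closed_graph_theorem:
  fixes f :: "'a::banach \<Rightarrow> 'b::banach"
  assumes lin: "linear f"
    and graph: "\<And>X a b. X \<longlonglongrightarrow> a \<Longrightarrow> (\<lambda>n. f (X n)) \<longlonglongrightarrow> b \<Longrightarrow> f a = b"
  shows "\<exists>B. \<forall>x. norm (f x) \<le> B * norm x"
proof -
  interpret linear f by (rule lin)
  define T where "T n = closure {x. norm (f x) \<le> real n}" for n
  have "(\<Union>n. T n) = UNIV"
  proof (rule UNIV_eq_I[symmetric])
    fix x
    have "x \<in> T (nat \<lceil>norm (f x)\<rceil>)"
      unfolding T_def by (rule subsetD[OF closure_subset]) (simp add: real_nat_ceiling_ge)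
    then show "x \<in> (\<Union>n. T n)" by blast
  qed
  then obtain n where "interior (T n) \<noteq> {}"
    using closed_cover_has_interior[of T] unfolding T_def by blast
  then obtain a r where r: "r > 0" "ball a r \<subseteq> T n"
    by (meson all_not_in_conv mem_interior)
  have symmetric: "\<exists>y. norm (f y) \<le> n \<and> norm (x - y) < e" if "norm x < r" "e > 0" for x e
  proof -
    have "a + x \<in> T n" "a - x \<in> T n"
      using r that by (auto intro!: subsetD[OF r(2)] simp: dist_norm)
    then obtain y z where y: "norm (f y) \<le> n" "dist y (a + x) < e"
      and z: "norm (f z) \<le> n" "dist z (a - x) < e"
      unfolding T_def closure_approachable using \<open>e > 0\<close> by blast
    have "norm (f (y - z)) \<le> 2 * n"
      using norm_triangle_ineq4[of "f y" "f z"] y z by (simp add: diff)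
    then have "norm (f ((1/2) *\<^sub>R (y - z))) \<le> n"
      by (simp add: scale)
    moreover have "norm (x - (1/2) *\<^sub>R (y - z)) < e"
    proof -
      have "x - (1/2) *\<^sub>R (y - z) = (1/2) *\<^sub>R ((a + x - y) - (a - x - z))"
        by (simp add: algebra_simps flip: scaleR_add_left)
      then have "norm (x - (1/2) *\<^sub>R (y - z)) = (1/2) * norm ((a + x - y) - (a - x - z))"
        by simp
      also have "\<dots> \<le> (1/2) * (dist y (a + x) + dist z (a - x))"
        using norm_triangle_ineq4[of "a + x - y" "a - x - z"] by (simp add: dist_norm norm_minus_commute)
      finally show ?thesis using y z by simp
    qed
    ultimately show ?thesis by blast
  qed
  define K where "K = 2 * n / r"
  have K0: "K \<ge> 0" unfolding K_def using r by simp
  have approx: "\<exists>y. norm (f y) \<le> K * norm x \<and> norm (x - y) < e" if "e > 0" for x e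
  proof (cases "x = 0")
    case True
    then show ?thesis using that by (intro exI[of _ 0]) (simp add: zero)
  next
    case False
    define t where "t = r / (2 * norm x)"
    have t: "t > 0" "norm (t *\<^sub>R x) < r" using False r unfolding t_def by auto
    obtain y where y: "norm (f y) \<le> n" "norm (t *\<^sub>R x - y) < t * e"
      using symmetric[OF t(2) mult_pos_pos[OF t(1) \<open>e > 0\<close>]] by blast
    have "norm (f ((1/t) *\<^sub>R y)) \<le> K * norm x"
      using y(1) t(1) r False by (simp add: scale K_def t_def field_simps)
    moreover have "norm (x - (1/t) *\<^sub>R y) < e"
    proof -
      have "x - (1/t) *\<^sub>R y = (1/t) *\<^sub>R (t *\<^sub>R x - y)"
        using t by (simp add: algebra_simps)
      then have "norm (x - (1/t) *\<^sub>R y) = norm (t *\<^sub>R x - y) / t" using t by simp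
      then show ?thesis using y(2) t by (simp add: pos_divide_less_eq mult.commute)
    qed
    ultimately show ?thesis by blast
  qed
  then have "\<forall>x e. \<exists>y. e > 0 \<longrightarrow> norm (f y) \<le> K * norm x \<and> norm (x - y) < e"
    by blast
  then obtain g where g: "\<And>x e. e > 0 \<Longrightarrow> norm (f (g x e)) \<le> K * norm x"
      "\<And>x e. e > 0 \<Longrightarrow> norm (x - g x e) < e"
    by metis
  have "norm (f x) \<le> 2 * K * norm x" for x
  proof (cases "x = 0")
    case False
    define c where "c = norm x"
    have c: "c > 0" using False unfolding c_def by simp
    \<comment> \<open>The error \<open>R k\<close> left after \<open>k\<close> approximations is at most \<open>c / 2 ^ k\<close>.\<close>
    define R where "R = rec_nat x (\<lambda>k z. z - g z (c / 2 ^ Suc k))"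
    define y where "y k = g (R k) (c / 2 ^ Suc k)" for k
    have R: "R 0 = x" "\<And>k. R (Suc k) = R k - y k" unfolding R_def y_def by simp_all
    have Rb: "norm (R k) \<le> c * (1/2) ^ k" for k
    proof (cases k)
      case 0 then show ?thesis using R c_def by simp
    next
      case (Suc j)
      then show ?thesis
        using g(2)[of "c / 2 ^ Suc j" "R j"] c R(2)[of j] unfolding y_def
        by (simp add: power_divide)
    qed
    have fy: "norm (f (y k)) \<le> K * c * (1/2) ^ k" for k
      using g(1)[of "c / 2 ^ Suc k" "R k"] c mult_left_mono[OF Rb[of k] K0] unfolding y_def
      by (simp add: mult.assoc)
    have geo: "(\<lambda>k. K * c * (1/2::real) ^ k) sums (K * c * 2)"
      using sums_mult[OF geometric_sums[of "1/2::real"], of "K * c"] by simp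
    have sn: "summable (\<lambda>k. norm (f (y k)))"
      by (rule summable_comparison_test'[OF sums_summable[OF geo]]) (use fy in auto)
    have part: "(\<Sum>k<m. y k) = x - R m" for m
      by (induction m) (use R in auto)
    have "(\<lambda>m. c * (1/2::real) ^ m) \<longlonglongrightarrow> c * 0"
      by (intro tendsto_mult tendsto_const LIMSEQ_realpow_zero) auto
    then have "R \<longlonglongrightarrow> 0"
      by (intro Lim_null_comparison[of R "\<lambda>m. c * (1/2) ^ m"]) (use Rb in auto)
    then have "(\<lambda>m. \<Sum>k<m. y k) \<longlonglongrightarrow> x"
      unfolding part using tendsto_diff[OF tendsto_const[of x]] by fastforce
    moreover have "(\<lambda>m. f (\<Sum>k<m. y k)) \<longlonglongrightarrow> (\<Sum>k. f (y k))"
      using summable_LIMSEQ[OF summable_norm_cancel[OF sn]] by (simp add: sum)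
    ultimately have "f x = (\<Sum>k. f (y k))" by (rule graph)
    also have "norm \<dots> \<le> (\<Sum>k. norm (f (y k)))" by (rule summable_norm[OF sn])
    also have "\<dots> \<le> (\<Sum>k. K * c * (1/2) ^ k)"
      by (rule suminf_le[OF fy sn sums_summable[OF geo]])
    also have "\<dots> = 2 * K * norm x" using sums_unique[OF geo] c_def by simp
    finally show ?thesis .
  qed (simp add: zero)
  then show ?thesis by blast
qed


section \<open>Linear sums of subspaces\<close>

lemma in_set_plusE:
  assumes "x \<in> A + B" obtains a b where "a \<in> A" "b \<in> B" "x = a + b"
  using assms by (auto elim: set_plus_elim)

lemma csubspace_set_plus:
  fixes A B :: "'a::complex_hilbert set"
  assumes "complex_vector.subspace A" "complex_vector.subspace B"
  shows "complex_vector.subspace (A + B)"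
proof -
  have "A + B = {x + y |x y. x \<in> A \<and> y \<in> B}"
    by (auto simp: set_plus_def)
  then show ?thesis using complex_vector.subspace_sums[OF assms] by simp
qed

lemma set_plus_self:
  fixes A :: "'a::complex_hilbert set"
  assumes "complex_vector.subspace A" shows "A + A = A"
  using complex_vector.subspace_add[OF assms] set_zero_plus2[of A A] complex_vector.subspace_0[OF assms]
  by (auto elim: set_plus_elim)

lemma set_plus_least:
  fixes A B C :: "'a::complex_hilbert set"
  assumes "complex_vector.subspace C" "A \<subseteq> C" "B \<subseteq> C" shows "A + B \<subseteq> C"
  using set_plus_mono2[OF assms(2,3)] set_plus_self[OF assms(1)] by simp

lemma set_plus_upper:
  fixes A B :: "'a::complex_hilbert set"
  shows "complex_vector.subspace B \<Longrightarrow> A \<subseteq> A + B" "complex_vector.subspace A \<Longrightarrow> B \<subseteq> A + B"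
  using set_zero_plus2[of B A] set_zero_plus2[of A B] complex_vector.subspace_0
  by (auto simp: add.commute)

text \<open>
  This law replaces distributivity throughout: it extracts a summand \<open>A\<close> of \<open>C\<close> from a sum that is
  larger than \<open>C\<close>.
\<close>

lemma modular_law:
  fixes A B C :: "'a::complex_hilbert set"
  assumes "complex_vector.subspace A" "complex_vector.subspace C" "A \<subseteq> C"
  shows "(A + B) \<inter> C = A + (B \<inter> C)"
proof
  show "(A + B) \<inter> C \<subseteq> A + (B \<inter> C)"
  proof
    fix x assume x: "x \<in> (A + B) \<inter> C"
    then obtain a b where ab: "a \<in> A" "b \<in> B" "x = a + b" by (auto elim: in_set_plusE)
    then have "x - a \<in> C" using x assms complex_vector.subspace_diff by blast
    then show "x \<in> A + (B \<inter> C)" using ab by auto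
  qed
  show "A + (B \<inter> C) \<subseteq> (A + B) \<inter> C"
    using set_plus_least[OF assms(2,3), of "B \<inter> C"] set_plus_mono2[of A A "B \<inter> C" B] by blast
qed

lemma closed_csubspace_Int:
  "closed_csubspace A \<Longrightarrow> closed_csubspace B \<Longrightarrow> closed_csubspace (A \<inter> B)"
  unfolding closed_csubspace_def by (auto intro: complex_vector.subspace_inter)

lemma closed_csubspace_zero: "closed_csubspace {0}"
  unfolding closed_csubspace_def by auto

lemma closed_csubspace_subspace: "closed_csubspace A \<Longrightarrow> complex_vector.subspace A"
  unfolding closed_csubspace_def by auto

lemma csubspace_scaleR:
  assumes "complex_vector.subspace A" "x \<in> A" shows "r *\<^sub>R x \<in> A"
  unfolding scaleR_scaleC by (rule complex_vector.subspace_scale[OF assms])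

lemma csubspace_convex:
  assumes "complex_vector.subspace A" shows "convex A"
  unfolding convex_def using assms by (auto intro!: complex_vector.subspace_add csubspace_scaleR)

lemma norm_scaleC: "norm (c *\<^sub>C x) = cmod c * norm x"
proof -
  have "cinner (c *\<^sub>C x) (c *\<^sub>C x) = c * cnj (cinner x (c *\<^sub>C x))"
    using cinner_commute[of "c *\<^sub>C x" x] by (simp add: cinner_scaleC_right)
  also have "\<dots> = (c * cnj c) * cinner x x"
    by (simp add: cinner_scaleC_right cinner_self)
  finally have "(norm (c *\<^sub>C x))^2 = (cmod c * norm x)^2"
    unfolding cinner_self complex_norm_square[symmetric]
    by (metis of_real_eq_iff of_real_mult power_mult_distrib)
  then show ?thesis by simp
qed

lemma csubspace_closure:
  fixes A :: "'a::complex_hilbert set"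
  assumes A: "complex_vector.subspace A" shows "complex_vector.subspace (closure A)"
proof (rule complex_vector.subspaceI)
  show "0 \<in> closure A"
    using complex_vector.subspace_0[OF A] closure_subset by blast
next
  fix x y assume "x \<in> closure A" "y \<in> closure A"
  then obtain X Y where "\<And>n::nat. X n \<in> A" "X \<longlonglongrightarrow> x" "\<And>n::nat. Y n \<in> A" "Y \<longlonglongrightarrow> y"
    unfolding closure_sequential by auto
  then show "x + y \<in> closure A"
    unfolding closure_sequential
    by (intro exI[of _ "\<lambda>n. X n + Y n"]) (auto intro: tendsto_add complex_vector.subspace_add[OF A])
next
  fix c :: complex and x assume "x \<in> closure A"
  then obtain X where X: "\<And>n::nat. X n \<in> A" "X \<longlonglongrightarrow> x"
    unfolding closure_sequential by auto
  have "bounded_linear (\<lambda>x::'a. c *\<^sub>C x)"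
    by (rule bounded_linear_intro[of _ "cmod c"])
       (simp_all add: scaleC_add_right scaleR_scaleC scaleC_scaleC norm_scaleC mult.commute)
  then have "(\<lambda>n. c *\<^sub>C X n) \<longlonglongrightarrow> c *\<^sub>C x"
    using X(2) by (rule bounded_linear.tendsto)
  then show "c *\<^sub>C x \<in> closure A"
    unfolding closure_sequential
    using X(1) by (intro exI[of _ "\<lambda>n. c *\<^sub>C X n"]) (auto intro: complex_vector.subspace_scale[OF A])
qed


section \<open>Orthogonal complements\<close>

definition orth_compl :: "'a::complex_hilbert set \<Rightarrow> 'a set"
  where "orth_compl V = {x. \<forall>v\<in>V. cinner v x = 0}"

text \<open>
  A minimizing sequence is Cauchy: by the parallelogram law, two points of \<open>V\<close> almost nearest to
  \<open>x\<close> cannot be far apart, because their midpoint lies in \<open>V\<close> too.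
\<close>

lemma nearest_point_exists:
  fixes V :: "'a::{real_inner,complete_space} set"
  assumes "closed V" "convex V" "V \<noteq> {}"
  shows "\<exists>v\<in>V. \<forall>w\<in>V. norm (x - v) \<le> norm (x - w)"
proof -
  define d where "d = infdist x V"
  have d: "d \<le> norm (x - w)" if "w \<in> V" for w
    using infdist_le[OF that, of x] by (simp add: d_def dist_norm)
  have d0: "d \<ge> 0" unfolding d_def by (rule infdist_nonneg)
  have ex: "\<exists>v\<in>V. norm (x - v)^2 < d^2 + e" if "e > 0" for e
  proof -
    have "d < sqrt (d^2 + e)" using that d0 by (simp add: real_less_rsqrt)
    then obtain v where "v \<in> V" "dist x v < sqrt (d^2 + e)"
      unfolding d_def infdist_notempty[OF assms(3)]
      by (subst (asm) cINF_less_iff) (use assms(3) in auto)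
    then have "(norm (x - v))^2 < (sqrt (d^2 + e))^2"
      by (intro power_strict_mono) (auto simp: dist_norm)
    then show ?thesis using \<open>v \<in> V\<close> that by (auto intro!: bexI[of _ v])
  qed
  have "\<forall>n. \<exists>v. v \<in> V \<and> norm (x - v)^2 < d^2 + 1 / Suc n"
    using ex by (meson divide_pos_pos of_nat_0_less_iff zero_less_Suc zero_less_one)
  then obtain v where v: "\<And>n. v n \<in> V" "\<And>n. norm (x - v n)^2 < d^2 + 1 / Suc n"
    by metis
  have close: "norm (v m - v n)^2 \<le> 2 / Suc m + 2 / Suc n" for m n
  proof -
    have "(1/2) *\<^sub>R v m + (1/2) *\<^sub>R v n \<in> V"
      using assms(2) v(1) by (simp add: convexD)
    then have "d \<le> norm (x - ((1/2) *\<^sub>R v m + (1/2) *\<^sub>R v n))" by (rule d)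
    then have "d^2 \<le> norm (x - ((1/2) *\<^sub>R v m + (1/2) *\<^sub>R v n))^2"
      using d0 by (intro power_mono) auto
    moreover have "norm (v m - v n)^2 = 2 * norm (x - v m)^2 + 2 * norm (x - v n)^2
        - 4 * norm (x - ((1/2) *\<^sub>R v m + (1/2) *\<^sub>R v n))^2"
      unfolding power2_norm_eq_inner
      by (simp add: algebra_simps inner_commute)
    ultimately show ?thesis using v(2)[of m] v(2)[of n] by simp
  qed
  have "Cauchy v"
  proof (rule metric_CauchyI)
    fix e :: real assume e: "e > 0"
    obtain M where M: "4 / e^2 < real (Suc M)" using reals_Archimedean2
      by (metis less_Suc_eq of_nat_less_iff order_less_trans)
    have "dist (v m) (v n) < e" if "m \<ge> M" "n \<ge> M" for m n
    proof -
      have "2 / real (Suc m) \<le> 2 / real (Suc M)" "2 / real (Suc n) \<le> 2 / real (Suc M)"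
        using that by (auto intro!: divide_left_mono)
      then have "norm (v m - v n)^2 \<le> 4 / real (Suc M)"
        using close[of m n] by simp
      also have "\<dots> < e^2" using M e by (simp add: field_simps)
      finally show ?thesis using e by (simp add: dist_norm power_less_imp_less_base)
    qed
    then show "\<exists>M. \<forall>m\<ge>M. \<forall>n\<ge>M. dist (v m) (v n) < e" by blast
  qed
  then obtain u where u: "v \<longlonglongrightarrow> u"
    using Cauchy_convergent_iff convergent_def by blast
  have "u \<in> V" using u v(1) assms(1) closed_sequentially by blast
  moreover have "norm (x - u)^2 \<le> d^2"
  proof (rule LIMSEQ_le)
    show "(\<lambda>n. norm (x - v n)^2) \<longlonglongrightarrow> norm (x - u)^2" by (intro tendsto_intros u)
    show "(\<lambda>n. d^2 + 1 / Suc n) \<longlonglongrightarrow> d^2"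
      using tendsto_add[OF tendsto_const LIMSEQ_inverse_real_of_nat, of "d^2"]
      by (simp add: inverse_eq_divide)
    show "\<exists>N. \<forall>n\<ge>N. norm (x - v n)^2 \<le> d^2 + 1 / Suc n" using v(2) less_imp_le by blast
  qed
  then have "norm (x - u) \<le> d" using d0 power2_le_imp_le by blast
  ultimately show ?thesis using d by force
qed

lemma cinner_0_right [simp]: "cinner x 0 = 0"
  using cinner_scaleC_right[of x 0 0] by simp

lemma cinner_eq_0_commute: "cinner x y = 0 \<longleftrightarrow> cinner y x = 0"
  using cinner_commute[of x y] cinner_commute[of y x] by auto

text \<open>
  The imaginary part of \<open>cinner v x\<close> is a real inner product as well, namely with \<open>\<i> *\<^sub>C v\<close>. Hence
  orthogonality to a complex subspace can be tested with the real inner product.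
\<close>

lemma cinner_eq_0_iff_inner: "cinner v x = 0 \<longleftrightarrow> v \<bullet> x = 0 \<and> (\<i> *\<^sub>C v) \<bullet> x = 0"
proof -
  have "cinner (\<i> *\<^sub>C v) x = - \<i> * cinner v x"
    using cinner_commute[of "\<i> *\<^sub>C v" x] cinner_commute[of v x]
    by (simp add: cinner_scaleC_right)
  then show ?thesis by (simp add: inner_cinner complex_eq_iff)
qed

lemma closed_csubspace_orth_compl: "closed_csubspace (orth_compl V)"
  unfolding closed_csubspace_def
proof
  show "complex_vector.subspace (orth_compl V)"
    unfolding orth_compl_def
    by (rule complex_vector.subspaceI) (auto simp: cinner_add_right cinner_scaleC_right)
  have "orth_compl V = (\<Inter>v\<in>V. {x. v \<bullet> x = 0} \<inter> {x. (\<i> *\<^sub>C v) \<bullet> x = 0})"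
    unfolding orth_compl_def cinner_eq_0_iff_inner by auto
  then show "closed (orth_compl V)"
    by (auto intro!: closed_INT closed_Int closed_Collect_eq continuous_intros)
qed

lemma orth_compl_antimono: "A \<subseteq> B \<Longrightarrow> orth_compl B \<subseteq> orth_compl A"
  unfolding orth_compl_def by blast

lemma inter_orth_compl: 
  assumes "complex_vector.subspace V" shows "V \<inter> orth_compl V = {0}"
  using complex_vector.subspace_0[OF assms] unfolding orth_compl_def by (auto simp: cinner_self)

lemma orth_compl_zero: "orth_compl {0} = UNIV"
  unfolding orth_compl_def using cinner_eq_0_commute by force

text \<open>
  If \<open>v\<close> is a point of \<open>V\<close> nearest to \<open>x\<close>, then \<open>x - v\<close> is orthogonal to \<open>V\<close>, since otherwise
  moving from \<open>v\<close> in some direction of \<open>V\<close> would decrease the distance.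
\<close>

lemma plus_orth_compl:
  fixes V :: "'a::complex_hilbert set"
  assumes "closed_csubspace V" shows "V + orth_compl V = UNIV"
proof (rule UNIV_eq_I[symmetric])
  fix x
  note V = closed_csubspace_subspace[OF assms]
  obtain v where v: "v \<in> V" "\<And>w. w \<in> V \<Longrightarrow> norm (x - v) \<le> norm (x - w)"
    using nearest_point_exists[of V x] assms csubspace_convex complex_vector.subspace_0
    unfolding closed_csubspace_def by blast
  have perp: "w \<bullet> (x - v) = 0" if w: "w \<in> V" for w
  proof (cases "w = 0")
    case False
    \<comment> \<open>The value of \<open>t\<close> for which \<open>v + t *\<^sub>R w\<close> is nearest to \<open>x\<close>.\<close>
    define t where "t = (w \<bullet> (x - v)) / (w \<bullet> w)"
    have "v + t *\<^sub>R w \<in> V" using v(1) w V csubspace_scaleR complex_vector.subspace_add by blast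
    then have "norm (x - v)^2 \<le> norm (x - (v + t *\<^sub>R w))^2"
      using v(2) by (intro power_mono) auto
    also have "\<dots> = norm (x - v)^2 - 2 * t * (w \<bullet> (x - v)) + t^2 * (w \<bullet> w)"
      unfolding power2_norm_eq_inner by (simp add: algebra_simps inner_commute power2_eq_square)
    also have "\<dots> = norm (x - v)^2 - (w \<bullet> (x - v))^2 / (w \<bullet> w)"
      using False by (simp add: t_def power2_eq_square field_simps)
    finally have "(w \<bullet> (x - v))^2 / (w \<bullet> w) \<le> 0" by simp
    moreover have "w \<bullet> w > 0" using False by simp
    ultimately show ?thesis by (simp add: divide_le_0_iff)
  qed simp
  have "x - v \<in> orth_compl V"
    unfolding orth_compl_def cinner_eq_0_iff_inner
    using perp complex_vector.subspace_scale[OF V] by blast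
  then have "v + (x - v) \<in> V + orth_compl V" using v(1) by (rule set_plus_intro[rotated])
  then show "x \<in> V + orth_compl V" by simp
qed

lemma corthogonal_sets_iff: "corthogonal_sets A B \<longleftrightarrow> B \<subseteq> orth_compl A"
  unfolding corthogonal_sets_def orth_compl_def by auto

lemma corthogonal_sets_commute: "corthogonal_sets A B \<longleftrightarrow> corthogonal_sets B A"
  unfolding corthogonal_sets_def using cinner_eq_0_commute by metis

lemma corthogonal_sets_plus_right:
  "corthogonal_sets A B \<Longrightarrow> corthogonal_sets A C \<Longrightarrow> corthogonal_sets A (B + C)"
  unfolding corthogonal_sets_iff
  by (rule set_plus_least[OF closed_csubspace_subspace[OF closed_csubspace_orth_compl]])

lemma corthogonal_sets_inter:
  assumes "complex_vector.subspace A" "complex_vector.subspace B" "corthogonal_sets A B"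
  shows "A \<inter> B = {0}"
  using assms inter_orth_compl[OF assms(1)] complex_vector.subspace_0
  unfolding corthogonal_sets_iff by blast

text \<open>
  The sum equals the orthogonal complement of \<open>orth_compl X \<inter> orth_compl Y\<close>, and orthogonal
  complements are closed.
\<close>

lemma closed_csubspace_orth_plus:
  fixes X Y :: "'a::complex_hilbert set"
  assumes X: "closed_csubspace X" and Y: "closed_csubspace Y" and orth: "corthogonal_sets X Y"
  shows "closed_csubspace (X + Y)"
proof -
  let ?Z = "orth_compl X \<inter> orth_compl Y"
  have "X + Y = orth_compl ?Z"
  proof
    show "X + Y \<subseteq> orth_compl ?Z"
      by (intro set_plus_least closed_csubspace_subspace[OF closed_csubspace_orth_compl])
         (auto simp: orth_compl_def cinner_eq_0_commute)
    show "orth_compl ?Z \<subseteq> X + Y"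
    proof
      fix h assume h: "h \<in> orth_compl ?Z"
      obtain x h' where x: "x \<in> X" "h' \<in> orth_compl X" "h = x + h'"
        using plus_orth_compl[OF X] by (metis UNIV_I in_set_plusE)
      obtain y z where y: "y \<in> Y" "z \<in> orth_compl Y" "h' = y + z"
        using plus_orth_compl[OF Y] by (metis UNIV_I in_set_plusE)
      have "h' - y \<in> orth_compl X"
        using x(2) y(1) orth unfolding corthogonal_sets_iff
        by (meson subsetD complex_vector.subspace_diff closed_csubspace_subspace closed_csubspace_orth_compl)
      then have z: "z \<in> ?Z" using y by simp
      then have "cinner z h = 0" "cinner z x = 0" "cinner z y = 0"
        using h x y by (auto simp: orth_compl_def cinner_eq_0_commute)
      then have "cinner z z = 0" using x y by (simp add: cinner_add_right)
      then have "z = 0" by (simp add: cinner_self)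
      then show "h \<in> X + Y" using x y by auto
    qed
  qed
  then show ?thesis using closed_csubspace_orth_compl by metis
qed

lemma bounded_clinear_iff:
  fixes f :: "'a::complex_hilbert \<Rightarrow> 'b::complex_hilbert"
  shows
  "bounded_clinear f \<longleftrightarrow> (\<forall>x y. f (x + y) = f x + f y) \<and> (\<forall>c x. f (c *\<^sub>C x) = c *\<^sub>C f x)
     \<and> (\<exists>B. \<forall>x. norm (f x) \<le> B * norm x)"
  unfolding bounded_clinear_def Vector_Spaces.linear_iff
  using complex_vector.vector_space_axioms[where 'a = 'a]
    complex_vector.vector_space_axioms[where 'a = 'b] by blast


section \<open>Orthogonalizing a topologically direct sum\<close>

lemma bounded_clinear_bounded_linear: 
  assumes "bounded_clinear f" shows "bounded_linear f"
proof -
  obtain B where "\<And>x. norm (f x) \<le> B * norm x" using assms unfolding bounded_clinear_iff by blast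
  then show ?thesis
    using assms unfolding bounded_clinear_iff
    by (intro bounded_linear_intro[of f B]) (auto simp: scaleR_scaleC mult.commute)
qed

lemma bounded_clinearI:
  assumes "\<And>x y. f (x + y) = f x + f y" "\<And>c x. f (c *\<^sub>C x) = c *\<^sub>C f x" "bounded_linear f"
  shows "bounded_clinear f"
  using assms(1,2) bounded_linear.bounded[OF assms(3)] unfolding bounded_clinear_iff
  by (auto simp: mult.commute)

lemma bounded_clinear_compose:
  assumes "bounded_clinear f" "bounded_clinear g"
  shows "bounded_clinear (f \<circ> g)"
proof (rule bounded_clinearI)
  show "bounded_linear (f \<circ> g)"
    using bounded_linear_compose[OF assms[THEN bounded_clinear_bounded_linear]] by (simp add: o_def)
qed (use assms in \<open>simp_all add: bounded_clinear_iff\<close>)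

lemma bounded_clinear_id: "bounded_clinear id"
  unfolding bounded_clinear_iff by (auto intro!: exI[of _ 1])

lemma bounded_clinear_plus:
  assumes "bounded_clinear f" "bounded_clinear g"
  shows "bounded_clinear (\<lambda>x. f x + g x)"
proof (rule bounded_clinearI)
  show "bounded_linear (\<lambda>x. f x + g x)"
    by (rule bounded_linear_add[OF assms[THEN bounded_clinear_bounded_linear]])
qed (use assms in \<open>simp_all add: bounded_clinear_iff scaleC_add_right\<close>)

lemma bounded_clinear_diff:
  assumes "bounded_clinear f" "bounded_clinear g"
  shows "bounded_clinear (\<lambda>x. f x - g x)"
proof (rule bounded_clinearI)
  show "bounded_linear (\<lambda>x. f x - g x)"
    by (rule bounded_linear_sub[OF assms[THEN bounded_clinear_bounded_linear]])
qed (use assms in \<open>simp_all add: bounded_clinear_iff complex_vector.scale_right_diff_distrib\<close>)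

text \<open>
  The graph of the projection is closed because both \<open>X\<close> and \<open>U\<close> are, so the closed graph theorem
  makes it bounded.
\<close>

lemma projection_along_exists:
  fixes X U :: "'a::complex_hilbert set"
  assumes X: "closed_csubspace X" and U: "closed_csubspace U"
    and sum: "X + U = UNIV" and disj: "X \<inter> U = {0}"
  shows "\<exists>p. bounded_clinear p \<and> (\<forall>x\<in>X. p x = x) \<and> (\<forall>u\<in>U. p u = 0) \<and>
    (\<forall>h. p h \<in> X \<and> h - p h \<in> U)"
proof -
  note sX = closed_csubspace_subspace[OF X] and sU = closed_csubspace_subspace[OF U]
  have "\<forall>h. \<exists>x. x \<in> X \<and> h - x \<in> U"
  proof
    fix h
    obtain x u where "x \<in> X" "u \<in> U" "h = x + u" using sum by (metis UNIV_I in_set_plusE)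
    then show "\<exists>x. x \<in> X \<and> h - x \<in> U" by (intro exI[of _ x]) simp
  qed
  then obtain p where p: "\<And>h. p h \<in> X" "\<And>h. h - p h \<in> U" by metis
  have unique: "p h = x" if "x \<in> X" "h - x \<in> U" for h x
  proof -
    have "p h - x \<in> X" using p(1) that(1) complex_vector.subspace_diff[OF sX] by blast
    moreover have "(h - x) - (h - p h) \<in> U"
      using p(2) that(2) complex_vector.subspace_diff[OF sU] by blast
    then have "p h - x \<in> U" by simp
    ultimately have "p h - x = 0" using disj by blast
    then show ?thesis by simp
  qed
  have add: "p (x + y) = p x + p y" for x y
  proof (rule unique)
    show "p x + p y \<in> X" by (intro complex_vector.subspace_add[OF sX] p)
    show "x + y - (p x + p y) \<in> U"
      using complex_vector.subspace_add[OF sU p(2)[of x] p(2)[of y]] by (simp add: algebra_simps)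
  qed
  have scale: "p (c *\<^sub>C x) = c *\<^sub>C p x" for c x
  proof (rule unique)
    show "c *\<^sub>C p x \<in> X" by (intro complex_vector.subspace_scale[OF sX] p)
    show "c *\<^sub>C x - c *\<^sub>C p x \<in> U"
      using complex_vector.subspace_scale[OF sU p(2)[of x], of c]
      by (simp add: complex_vector.scale_right_diff_distrib)
  qed
  have "\<exists>B. \<forall>x. norm (p x) \<le> B * norm x"
  proof (rule closed_graph_theorem)
    show "linear p" by (rule linearI) (simp_all add: add scale scaleR_scaleC)
    fix Y a b assume Y: "Y \<longlonglongrightarrow> a" "(\<lambda>n. p (Y n)) \<longlonglongrightarrow> b"
    have "b \<in> X"
      using Y(2) p(1) X unfolding closed_csubspace_def by (metis closed_sequentially)
    moreover have "(\<lambda>n. Y n - p (Y n)) \<longlonglongrightarrow> a - b" using Y by (intro tendsto_diff)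
    then have "a - b \<in> U"
      using p(2) U unfolding closed_csubspace_def by (metis (no_types, lifting) closed_sequentially)
    ultimately show "p a = b" by (rule unique)
  qed
  then have "bounded_clinear p" unfolding bounded_clinear_iff using add scale by blast
  then show ?thesis
    using p unique complex_vector.subspace_0[OF sX] complex_vector.subspace_0[OF sU]
    by (intro exI[of _ p]) auto
qed

definition clinear_homeo :: "('a::complex_hilbert \<Rightarrow> 'b::complex_hilbert) \<Rightarrow> bool"
  where "clinear_homeo \<phi> \<longleftrightarrow> bounded_clinear \<phi> \<and> bij \<phi> \<and> bounded_clinear (inv \<phi>)"

lemma clinear_homeo_compose:
  assumes "clinear_homeo f" "clinear_homeo g" shows "clinear_homeo (f \<circ> g)"
  using assms unfolding clinear_homeo_def
  by (simp add: bounded_clinear_compose bij_comp o_inv_distrib)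

lemma clinear_homeo_id: "clinear_homeo id"
  unfolding clinear_homeo_def using bounded_clinear_id by (simp del: id_apply)

text \<open>
  Subtracting from \<open>x \<in> X\<close> its orthogonal projection to \<open>W\<close> makes \<open>X\<close> orthogonal to \<open>W\<close>. To extend
  this to the whole space, let \<open>p\<close> project to \<open>X\<close> along \<open>W + orth_compl V\<close> and \<open>q\<close> orthogonally to
  \<open>W\<close>. The operator \<open>q \<circ> p\<close> has square zero since \<open>p\<close> vanishes on \<open>W\<close>, so \<open>id - q \<circ> p\<close> is
  invertible with inverse \<open>id + q \<circ> p\<close>.
\<close>

lemma orthogonalize_complement:
  fixes V X W :: "'a::complex_hilbert set"
  assumes V: "closed_csubspace V" and X: "closed_csubspace X" and W: "closed_csubspace W"
    and VXW: "V = X + W" and disj: "X \<inter> W = {0}"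
  shows "\<exists>\<psi>. clinear_homeo \<psi> \<and> (\<forall>w\<in>W. \<psi> w = w) \<and> (\<forall>z\<in>orth_compl V. \<psi> z = z) \<and>
    (\<forall>x\<in>X. \<psi> x \<in> V \<inter> orth_compl W)"
proof -
  note sV = closed_csubspace_subspace[OF V] and sX = closed_csubspace_subspace[OF X]
    and sW = closed_csubspace_subspace[OF W]
  have XV: "X \<subseteq> V" and WV: "W \<subseteq> V" unfolding VXW using set_plus_upper sX sW by blast+
  let ?U = "W + orth_compl V"
  have U: "closed_csubspace ?U"
    by (intro closed_csubspace_orth_plus W closed_csubspace_orth_compl)
       (unfold corthogonal_sets_iff, rule orth_compl_antimono[OF WV])
  have "X + ?U = UNIV"
    using plus_orth_compl[OF V] by (simp add: VXW add.assoc)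
  moreover have "X \<inter> ?U = {0}"
  proof -
    have "X \<inter> ?U \<subseteq> ?U \<inter> V" using XV by blast
    also have "\<dots> = W + orth_compl V \<inter> V" by (rule modular_law[OF sW sV WV])
    also have "\<dots> = W" using inter_orth_compl[OF sV] by (simp add: Int_commute)
    finally have "X \<inter> ?U \<subseteq> X \<inter> W" by blast
    moreover have "0 \<in> X \<inter> ?U"
      using complex_vector.subspace_0 sX closed_csubspace_subspace[OF U] by blast
    ultimately show ?thesis using disj by blast
  qed
  ultimately obtain p where p: "bounded_clinear p" "\<forall>x\<in>X. p x = x" "\<forall>u\<in>?U. p u = 0"
    using projection_along_exists[OF X U] by blast
  obtain q where q: "bounded_clinear q" "\<forall>h. q h \<in> W \<and> h - q h \<in> orth_compl W"
    using projection_along_exists[OF W closed_csubspace_orth_compl[of W] plus_orth_compl[OF W]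
       inter_orth_compl[OF sW]] by blast
  have WU: "W \<subseteq> ?U" and VU: "orth_compl V \<subseteq> ?U"
    using set_plus_upper sW closed_csubspace_subspace[OF closed_csubspace_orth_compl] by blast+
  have pq: "p (q h) = 0" for h using p(3) q(2) WU by blast
  have q0: "q 0 = 0" using q(1) unfolding bounded_clinear_iff by (metis add_cancel_right_right)
  define \<psi> where "\<psi> = (\<lambda>h. h - q (p h))"
  define \<psi>' where "\<psi>' = (\<lambda>h. h + q (p h))"
  have b: "bounded_clinear \<psi>" "bounded_clinear \<psi>'"
    unfolding \<psi>_def \<psi>'_def
    using bounded_clinear_diff[OF bounded_clinear_id bounded_clinear_compose[OF q(1) p(1)]]
      bounded_clinear_plus[OF bounded_clinear_id bounded_clinear_compose[OF q(1) p(1)]]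
    by simp_all
  have inverse: "\<psi>' (\<psi> h) = h" "\<psi> (\<psi>' h) = h" for h
    using p(1) pq bounded_linear.linear[OF bounded_clinear_bounded_linear[OF p(1)]] 
    unfolding \<psi>_def \<psi>'_def by (simp_all add: linear_add linear_diff)
  have "bij \<psi>" by (rule o_bij[of \<psi>']) (use inverse in auto)
  moreover have "inv \<psi> = \<psi>'" by (rule inv_equality) (rule inverse)+
  ultimately have homeo: "clinear_homeo \<psi>" unfolding clinear_homeo_def using b by simp
  have *: "\<psi> x = x - q x" if "x \<in> X" for x unfolding \<psi>_def using p(2) that by simp
  show ?thesis
  proof (intro exI[of _ \<psi>] conjI ballI homeo)
    show "\<psi> w = w" if "w \<in> W" for w unfolding \<psi>_def using that p(3) WU q0 by auto
    show "\<psi> z = z" if "z \<in> orth_compl V" for z unfolding \<psi>_def using that p(3) VU q0 by auto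
    show "\<psi> x \<in> V \<inter> orth_compl W" if "x \<in> X" for x
      unfolding *[OF that]
      using that XV WV q(2) complex_vector.subspace_diff[OF sV] by blast
  qed
qed

text \<open>
  A list of subspaces is split from the front: each one has a topologically direct sum with the sum
  of those after it. Closedness is demanded of all these tails, so that every splitting has a
  bounded projection.
\<close>

fun top_direct :: "'a::complex_hilbert set list \<Rightarrow> bool" where
  "top_direct [] \<longleftrightarrow> True"
| "top_direct (X # Xs) \<longleftrightarrow> closed_csubspace X \<and> closed_csubspace (X + sum_list Xs) \<and>
     X \<inter> sum_list Xs = {0} \<and> top_direct Xs"

lemma top_direct_closed_csubspace:
  "top_direct Xs \<Longrightarrow> closed_csubspace (sum_list Xs)"
  by (cases Xs) (auto simp: closed_csubspace_zero set_zero)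

lemma top_direct_member:
  "top_direct Xs \<Longrightarrow> X \<in> set Xs \<Longrightarrow> closed_csubspace X"
  by (induction Xs) auto

lemma csubspace_sum_list:
  fixes Xs :: "'a::complex_hilbert set list"
  assumes "\<And>Y. Y \<in> set Xs \<Longrightarrow> complex_vector.subspace Y"
  shows "complex_vector.subspace (sum_list Xs)"
  using assms by (induction Xs) (auto simp: set_zero intro: csubspace_set_plus)

lemma member_subset_sum_list:
  fixes Xs :: "'a::complex_hilbert set list"
  assumes "\<And>Y. Y \<in> set Xs \<Longrightarrow> complex_vector.subspace Y" "X \<in> set Xs"
  shows "X \<subseteq> sum_list Xs"
  using assms
proof (induction Xs)
  case (Cons Y Ys)
  have "Y \<subseteq> Y + sum_list Ys" "sum_list Ys \<subseteq> Y + sum_list Ys"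
    using Cons.prems(1) by (auto intro!: set_plus_upper csubspace_sum_list)
  then show ?case using Cons by auto
qed simp

text \<open>
  The homeomorphism for the tail is the identity on the orthogonal complement of the tail sum \<open>W\<close>.
  Hence it does not disturb the head once that has been made orthogonal to \<open>W\<close>, and the two maps
  can be composed. The first two properties of \<open>\<phi>\<close> are what the induction needs.
\<close>

lemma orthogonalize_top_direct:
  fixes Xs :: "'a::complex_hilbert set list"
  assumes "top_direct Xs"
  shows "\<exists>\<phi>. clinear_homeo \<phi> \<and> (\<forall>z\<in>orth_compl (sum_list Xs). \<phi> z = z) \<and>
    \<phi> ` sum_list Xs \<subseteq> sum_list Xs \<and> sorted_wrt corthogonal_sets (map ((`) \<phi>) Xs)"
  using assms
proof (induction Xs)
  case Nil
  then show ?case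
    by (intro exI[of _ id] conjI clinear_homeo_id) simp_all
next
  case (Cons X Xs)
  define W where "W = sum_list Xs"
  define V where "V = X + W"
  have X: "closed_csubspace X" and V: "closed_csubspace V" and W: "closed_csubspace W"
    and disj: "X \<inter> W = {0}" and Xs: "top_direct Xs"
    using Cons.prems top_direct_closed_csubspace unfolding W_def V_def by auto
  note sV = closed_csubspace_subspace[OF V] and sX = closed_csubspace_subspace[OF X]
    and sW = closed_csubspace_subspace[OF W]
  have WV: "W \<subseteq> V" unfolding V_def using set_plus_upper sX by blast
  obtain \<theta> where \<theta>: "clinear_homeo \<theta>" "\<And>z. z \<in> orth_compl W \<Longrightarrow> \<theta> z = z" "\<theta> ` W \<subseteq> W"
      "sorted_wrt corthogonal_sets (map ((`) \<theta>) Xs)"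
    using Cons.IH[OF Xs] unfolding W_def by blast
  obtain \<psi> where \<psi>: "clinear_homeo \<psi>" "\<forall>w\<in>W. \<psi> w = w"
    "\<forall>z\<in>orth_compl V. \<psi> z = z" "\<forall>x\<in>X. \<psi> x \<in> V \<inter> orth_compl W"
    using orthogonalize_complement[OF V X W V_def disj] by blast
  define \<phi> where "\<phi> = \<theta> \<circ> \<psi>"
  have \<phi>X: "\<phi> x \<in> V \<inter> orth_compl W" if "x \<in> X" for x
    unfolding \<phi>_def using \<psi>(4) that \<theta>(2) by auto
  have \<phi>W: "\<phi> w = \<theta> w" if "w \<in> W" for w unfolding \<phi>_def using \<psi>(2) that by simp
  have homeo: "clinear_homeo \<phi>" unfolding \<phi>_def by (rule clinear_homeo_compose[OF \<theta>(1) \<psi>(1)])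
  have "\<phi> z = z" if "z \<in> orth_compl V" for z
    unfolding \<phi>_def using \<psi>(3) that \<theta>(2) that orth_compl_antimono[OF WV] by auto
  moreover have "\<phi> ` V \<subseteq> V"
  proof
    fix v assume "v \<in> \<phi> ` V"
    then obtain x w where xw: "x \<in> X" "w \<in> W" "v = \<phi> (x + w)"
      unfolding V_def by (auto elim: in_set_plusE)
    have "\<phi> (x + w) = \<phi> x + \<phi> w"
      using homeo unfolding clinear_homeo_def bounded_clinear_iff by blast
    then show "v \<in> V"
      using xw \<phi>X[of x] \<phi>W[of w] \<theta>(3) WV by (auto intro!: complex_vector.subspace_add[OF sV])
  qed
  moreover have maps: "map ((`) \<phi>) Xs = map ((`) \<theta>) Xs"
  proof (intro map_cong refl image_cong)
    fix Y y assume "Y \<in> set Xs" "y \<in> Y"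
    then have "y \<in> W"
      unfolding W_def using member_subset_sum_list top_direct_member[OF Xs] closed_csubspace_subspace by blast
    then show "\<phi> y = \<theta> y" by (rule \<phi>W)
  qed
  have "corthogonal_sets (\<phi> ` X) (\<theta> ` Y)" if "Y \<in> set Xs" for Y
  proof -
    have "Y \<subseteq> W"
      unfolding W_def using that member_subset_sum_list top_direct_member[OF Xs] closed_csubspace_subspace by blast
    then have "\<theta> ` Y \<subseteq> W" using \<theta>(3) by blast
    moreover have "\<phi> ` X \<subseteq> orth_compl W" using \<phi>X by blast
    ultimately have "\<phi> ` X \<subseteq> orth_compl (\<theta> ` Y)" using orth_compl_antimono by blast
    then show ?thesis using corthogonal_sets_iff corthogonal_sets_commute by blast
  qed
  then have "sorted_wrt corthogonal_sets (map ((`) \<phi>) (X # Xs))"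
    unfolding list.map maps using \<theta>(4) by simp
  ultimately show ?case
    using homeo unfolding V_def W_def sum_list.Cons by blast
qed


section \<open>Splitting a system of three subspaces\<close>

lemma join_closed_csubspace:
  "closed_csubspace A \<Longrightarrow> closed_csubspace B \<Longrightarrow> closed_csubspace (A \<or>\<^sub>H B)"
  unfolding join_def closed_csubspace_def by (auto intro!: csubspace_closure csubspace_set_plus)

lemma join_commute: "A \<or>\<^sub>H B = B \<or>\<^sub>H A"
  unfolding join_def by (simp add: add.commute)

lemma join_least: 
  assumes "closed_csubspace C" "A \<subseteq> C" "B \<subseteq> C" shows "A \<or>\<^sub>H B \<subseteq> C"
  using assms closure_minimal[OF set_plus_least[of C A B]] unfolding join_def closed_csubspace_def
  by blast

lemma join_upper:
  assumes "closed_csubspace A" "closed_csubspace B" shows "A \<subseteq> A \<or>\<^sub>H B" "B \<subseteq> A \<or>\<^sub>H B"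
  using set_plus_upper[of B A] set_plus_upper[of A B] assms closure_subset[of "A + B"]
  unfolding join_def closed_csubspace_def by auto

lemma relative_orth_complement:
  assumes "closed_csubspace X" "complex_vector.subspace Y" "X \<subseteq> Y"
  shows "X + Y \<inter> orth_compl X = Y"
  using modular_law[OF closed_csubspace_subspace[OF assms(1)] assms(2,3), of "orth_compl X"]
    plus_orth_compl[OF assms(1)] by (simp add: Int_commute)

text \<open>
  Applied to \<open>A = E i\<close> and the join \<open>V\<close> of the other two subspaces this gives the summand \<open>M i\<close>;
  applied to the meet \<open>A\<close> of two subspaces and the third one \<open>V\<close> it gives \<open>N i\<close>.
\<close>

lemma complement_relative_to:
  fixes A V :: "'a::complex_hilbert set"
  assumes A: "closed_csubspace A" and V: "closed_csubspace V"
  defines "M \<equiv> A \<inter> orth_compl (A \<inter> V)"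
  shows "closed_csubspace M" "A \<inter> V + M = A" "M \<inter> V = {0}" "V + M = V + A"
proof -
  have AV: "closed_csubspace (A \<inter> V)" by (rule closed_csubspace_Int[OF A V])
  show "closed_csubspace M"
    unfolding M_def by (intro closed_csubspace_Int A closed_csubspace_orth_compl)
  show eq: "A \<inter> V + M = A"
    unfolding M_def by (rule relative_orth_complement[OF AV closed_csubspace_subspace[OF A]]) blast
  show "M \<inter> V = {0}"
    using inter_orth_compl[OF closed_csubspace_subspace[OF AV]] unfolding M_def by blast
  have "V + A \<inter> V = V"
    using set_plus_least[of V V "A \<inter> V"] set_plus_upper(1)[of "A \<inter> V" V]
      closed_csubspace_subspace[OF V] closed_csubspace_subspace[OF AV] by blast
  then show "V + M = V + A" by (metis eq add.assoc)
qed

text \<open>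
  A complement \<open>N\<close> of \<open>V\<close> in \<open>T\<close> also has a complement in the larger space \<open>K\<close> that contains \<open>V\<close>:
  add to \<open>V\<close> what is orthogonal to \<open>T\<close> in \<open>K\<close>.
\<close>

lemma closed_complement_containing:
  fixes K V T N :: "'a::complex_hilbert set"
  assumes K: "complex_vector.subspace K" and V: "closed_csubspace V" and T: "closed_csubspace T"
    and N: "complex_vector.subspace N" and NV: "N \<inter> V = {0}" and sum: "N + V = T" and TK: "T \<subseteq> K"
  defines "P \<equiv> V + K \<inter> orth_compl T"
  shows "N + P = K" "N \<inter> P = {0}" "V \<subseteq> P"
proof -
  note sV = closed_csubspace_subspace[OF V] and sT = closed_csubspace_subspace[OF T]
  have VT: "V \<subseteq> T" and NT: "N \<subseteq> T" using sum set_plus_upper sV N by blast+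
  have sKT: "complex_vector.subspace (K \<inter> orth_compl T)"
    by (intro complex_vector.subspace_inter K closed_csubspace_subspace closed_csubspace_orth_compl)
  show "N + P = K"
    using relative_orth_complement[OF T K TK] by (simp add: P_def add.assoc[symmetric] sum)
  have "P \<inter> T = V + (K \<inter> orth_compl T) \<inter> T"
    unfolding P_def by (rule modular_law[OF sV sT VT])
  also have "(K \<inter> orth_compl T) \<inter> T = {0}"
    using inter_orth_compl[OF sT] complex_vector.subspace_0[OF K] by blast
  finally have "P \<inter> T = V" by simp
  then show "N \<inter> P = {0}" using NT NV by blast
  show "V \<subseteq> P" unfolding P_def by (rule set_plus_upper(1)[OF sKT])
qed

text \<open>
  If \<open>X\<close> and \<open>Y\<close> together cover \<open>Z\<close> and \<open>X\<close> lies inside \<open>Z\<close>, then \<open>X\<close> can be split off from \<open>Z\<close>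
  with remainder \<open>Z \<inter> Y\<close>.
\<close>

lemma summand_split:
  fixes X Y Z :: "'a::complex_hilbert set"
  assumes "complex_vector.subspace X" "complex_vector.subspace Z" "X \<subseteq> Z" "Z \<subseteq> X + Y"
  shows "X + Z \<inter> Y = Z"
  using modular_law[OF assms(1-3), of Y] assms(4) by (simp add: Int_commute Int_absorb2)

definition distinct3 :: "nat \<Rightarrow> nat \<Rightarrow> nat \<Rightarrow> bool" where
  "distinct3 i j k \<longleftrightarrow> i \<in> {1,2,3} \<and> j \<in> {1,2,3} \<and> k \<in> {1,2,3} \<and> i \<noteq> j \<and> j \<noteq> k \<and> k \<noteq> i"

lemma distinct3_rotate: "distinct3 i j k \<Longrightarrow> distinct3 j k i"
  and distinct3_swap: "distinct3 i j k \<Longrightarrow> distinct3 j i k"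
  unfolding distinct3_def by auto

lemma distinct3_cases:
  assumes "distinct3 i j k"
  shows "(i,j,k) \<in> {(1,2,3),(1,3,2),(2,1,3),(2,3,1),(3,1,2),(3,2,1)}"
  using assms unfolding distinct3_def by auto

lemma distinct3_instances: "distinct3 1 2 3" "distinct3 2 1 3" "distinct3 3 1 2" "distinct3 3 2 1"
  unfolding distinct3_def by auto

text \<open>
  A Brenner type decomposition before the summands are made orthogonal, with \<open>E i \<inter> Q\<close> in the role of
  \<open>Q\<^sub>i\<close>. Instead of the density of \<open>E i \<inter> Q + E j \<inter> Q\<close> in \<open>Q\<close> it only records that \<open>Q\<close> lies in the
  join of \<open>E i\<close> and \<open>E j\<close>; density is a consequence once the summands are orthogonal.
\<close>

definition brenner_summands where
  "brenner_summands E L M N S Q \<longleftrightarrow>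
    top_direct [L, M 1, M 2, M 3, N 1, N 2, N 3, S, Q] \<and>
    sum_list [L, M 1, M 2, M 3, N 1, N 2, N 3, S, Q] = UNIV \<and>
    (\<forall>i j k. distinct3 i j k \<longrightarrow>
       E i = S + (N j + (N k + (M i + (E i \<inter> Q)))) \<and> E i \<inter> E j \<inter> Q = {0} \<and> Q \<subseteq> E i \<or>\<^sub>H E j)"

text \<open>
  The chain of direct splittings, for \<open>R i\<close> and \<open>I i\<close> the join and the meet of the two subspaces
  other than \<open>E i\<close>, is: the whole space into \<open>orth_compl J\<close> and \<open>J\<close>; \<open>J\<close> into \<open>M 1\<close> and \<open>R 1\<close>; \<open>R 1\<close>
  into \<open>M 2\<close> and \<open>R 1 \<inter> R 2\<close>; \<open>R 1 \<inter> R 2\<close> into \<open>M 3\<close> and \<open>K\<close>; \<open>K\<close> into \<open>N 1\<close> and \<open>P 1\<close>; \<open>P 1\<close> into \<open>N 2\<close>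
  and \<open>P 1 \<inter> P 2\<close>; \<open>P 1 \<inter> P 2\<close> into \<open>N 3\<close> and \<open>P0\<close>; \<open>P0\<close> into \<open>S\<close> and \<open>Q\<close>. It works because \<open>M i\<close> lies
  in \<open>R j\<close>, and \<open>N i\<close> in \<open>P j\<close>, whenever \<open>j\<close> differs from \<open>i\<close>. The hypotheses make \<open>J\<close> closed,
  and also \<open>T i = (I i + E i) \<inter> K\<close>; the latter therefore has an orthogonal complement in \<open>K\<close>, which
  enlarges \<open>E i \<inter> K\<close> to \<open>P i\<close>. Each \<open>E i\<close> splits along the same chain, because at every step it
  either contains the summand split off or lies in the remainder.
\<close>

lemma brenner_summands_exist:
  fixes E :: "nat \<Rightarrow> 'a::complex_hilbert set"
  assumes E: "\<And>i. i \<in> {1,2,3} \<Longrightarrow> closed_csubspace (E i)"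
    and join_sum: "\<And>i j k. distinct3 i j k \<Longrightarrow> closed ((E i \<or>\<^sub>H E j) + E k)"
    and meet_sum: "\<And>i j k. distinct3 i j k \<Longrightarrow> closed ((E i \<inter> E j) + E k)"
  shows "\<exists>L M N S Q. brenner_summands E L M N S Q"
proof -
  define R where "R i = (if i = 1 then E 2 \<or>\<^sub>H E 3 else if i = 2 then E 1 \<or>\<^sub>H E 3 else E 1 \<or>\<^sub>H E 2)" for i :: nat
  define I where "I i = (if i = 1 then E 2 \<inter> E 3 else if i = 2 then E 1 \<inter> E 3 else E 1 \<inter> E 2)" for i :: nat
  define K where "K = R 1 \<inter> R 2 \<inter> R 3"
  define S where "S = E 1 \<inter> E 2 \<inter> E 3"
  define J where "J = R 1 + E 1"
  define M where "M i = E i \<inter> orth_compl (E i \<inter> R i)" for i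
  define N where "N i = I i \<inter> orth_compl (I i \<inter> (E i \<inter> K))" for i
  define T where "T i = I i + E i \<inter> K" for i
  define P where "P i = E i \<inter> K + K \<inter> orth_compl (T i)" for i
  define P0 where "P0 = P 1 \<inter> P 2 \<inter> P 3"
  define Q where "Q = P0 \<inter> orth_compl S"

  have cE: "closed_csubspace (E i)" "closed_csubspace (E j)" "closed_csubspace (E k)"
    if "distinct3 i j k" for i j k using that E unfolding distinct3_def by auto
  have R: "R i = E j \<or>\<^sub>H E k" and I: "I i = E j \<inter> E k"
    and Kall: "K = R i \<inter> R j \<inter> R k" and Sall: "S = E i \<inter> E j \<inter> E k"
    and Pall_eq: "P0 = P i \<inter> P j \<inter> P k" if "distinct3 i j k" for i j k
    using distinct3_cases[OF that] unfolding R_def I_def K_def S_def P0_def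
    by (auto simp: join_commute)
  have ex3: "\<exists>j k. distinct3 i j k" if "i \<in> {1,2,3}" for i
    using that distinct3_instances by blast
  have cR: "closed_csubspace (R i)" and cI: "closed_csubspace (I i)" if "i \<in> {1,2,3}" for i
    using ex3[OF that] R I cE join_closed_csubspace closed_csubspace_Int by metis+
  have cK: "closed_csubspace K"
    unfolding K_def by (intro closed_csubspace_Int cR) auto
  have ER: "E j \<subseteq> R i" "E k \<subseteq> R i" if "distinct3 i j k" for i j k
    using R[OF that] join_upper cE[OF that] by metis+
  have IK: "I i \<subseteq> K" if d: "distinct3 i j k" for i j k
    using ER[OF d] ER[OF distinct3_rotate[OF d]] ER[OF distinct3_swap[OF d]]
      ER[OF distinct3_rotate[OF distinct3_rotate[OF d]]]
    unfolding I[OF d] Kall[OF d] by blast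
  have EK: "E i \<inter> K = E i \<inter> R i" if d: "distinct3 i j k" for i j k
    using ER[OF distinct3_rotate[OF d]] ER[OF distinct3_rotate[OF distinct3_rotate[OF d]]]
    unfolding Kall[OF d] by blast
  have cRE: "closed_csubspace (R i + E i)" if d: "distinct3 i j k" for i j k
    using join_sum[OF distinct3_rotate[OF d]] csubspace_set_plus cR[of i] cE[OF d] d R[OF d]
    unfolding closed_csubspace_def distinct3_def by auto
  \<comment> \<open>All three sums \<open>R i + E i\<close> are closed, so each of them is the closed span of the system.\<close>
  have RE_le: "R i + E i \<subseteq> R j + E j" if d: "distinct3 i j k" for i j k
  proof -
    note c = cRE[OF distinct3_swap[OF d]]
    have "R j \<subseteq> R j + E j" "E j \<subseteq> R j + E j"
      using set_plus_upper cR[of j] cE[OF d] d unfolding distinct3_def closed_csubspace_def by blast+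
    then have "E i \<subseteq> R j + E j" "E j \<subseteq> R j + E j" "E k \<subseteq> R j + E j"
      using ER[OF distinct3_swap[OF d]] by blast+
    then show ?thesis
      unfolding R[OF d] using c
      by (intro set_plus_least join_least closed_csubspace_subspace[OF c])
  qed
  have J: "R i + E i = J" if "i \<in> {1,2,3}" for i
    using that RE_le distinct3_instances distinct3_rotate distinct3_swap unfolding J_def by blast
  have cJ: "closed_csubspace J" unfolding J_def by (rule cRE[OF distinct3_instances(1)])

  have M: "closed_csubspace (M i)" "E i \<inter> K + M i = E i" "M i \<inter> R i = {0}" "M i + R i = J" "M i \<subseteq> E i"
    if d: "distinct3 i j k" for i j k
  proof -
    have i: "i \<in> {1,2,3}" using d unfolding distinct3_def by auto
    note c = complement_relative_to[OF cE(1)[OF d] cR[OF i], folded M_def]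
    show "closed_csubspace (M i)" "E i \<inter> K + M i = E i" "M i \<inter> R i = {0}"
      using c EK[OF d] by simp_all
    show "M i + R i = J" using c(4) J[OF i] by (simp add: add.commute)
    show "M i \<subseteq> E i" unfolding M_def by blast
  qed
  have MR: "M i \<subseteq> R j" if d: "distinct3 i j k" for i j k
    using M(5)[OF d] ER(1)[OF distinct3_swap[OF d]] by blast

  have IES: "I i \<inter> (E i \<inter> K) = S" if d: "distinct3 i j k" for i j k
    using IK[OF d] unfolding Sall[OF d] I[OF d] by blast
  have N: "closed_csubspace (N i)" "S + N i = I i" "N i \<inter> (E i \<inter> K) = {0}" "N i + E i \<inter> K = T i"
    "N i \<subseteq> I i" if d: "distinct3 i j k" for i j k
  proof -
    have i: "i \<in> {1,2,3}" using d unfolding distinct3_def by auto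
    note c = complement_relative_to[OF cI[OF i] closed_csubspace_Int[OF cE(1)[OF d] cK], folded N_def]
    show "closed_csubspace (N i)" "S + N i = I i" "N i \<inter> (E i \<inter> K) = {0}"
      using c IES[OF d] by simp_all
    show "N i + E i \<inter> K = T i" using c(4) unfolding T_def by (simp add: add.commute)
    show "N i \<subseteq> I i" unfolding N_def by blast
  qed
  have T: "closed_csubspace (T i)" "T i \<subseteq> K" if d: "distinct3 i j k" for i j k
  proof -
    have i: "i \<in> {1,2,3}" using d unfolding distinct3_def by auto
    have "T i = (I i + E i) \<inter> K"
      unfolding T_def using modular_law[OF closed_csubspace_subspace[OF cI[OF i]]
        closed_csubspace_subspace[OF cK] IK[OF d]] by simp
    moreover have "closed_csubspace (I i + E i)"
      using meet_sum[OF distinct3_rotate[OF d]] csubspace_set_plus cI[OF i] cE(1)[OF d]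
      unfolding I[OF d] closed_csubspace_def by blast
    ultimately show "closed_csubspace (T i)" "T i \<subseteq> K" using closed_csubspace_Int[OF _ cK] by auto
  qed
  have P: "closed_csubspace (P i)" "N i + P i = K" "N i \<inter> P i = {0}" "E i \<inter> K \<subseteq> P i"
    if d: "distinct3 i j k" for i j k
  proof -
    have cEK: "closed_csubspace (E i \<inter> K)" by (rule closed_csubspace_Int[OF cE(1)[OF d] cK])
    show "N i + P i = K" "N i \<inter> P i = {0}" "E i \<inter> K \<subseteq> P i"
      using closed_complement_containing[OF closed_csubspace_subspace[OF cK] cEK T(1)[OF d]
        closed_csubspace_subspace[OF N(1)[OF d]] N(3)[OF d] N(4)[OF d] T(2)[OF d]]
      unfolding P_def by auto
    have "closed_csubspace (I i)" using cI d unfolding distinct3_def by simp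
    then have "E i \<inter> K \<subseteq> T i"
      unfolding T_def by (intro set_plus_upper(2) closed_csubspace_subspace)
    then have "corthogonal_sets (E i \<inter> K) (K \<inter> orth_compl (T i))"
      unfolding corthogonal_sets_iff using orth_compl_antimono by blast
    then show "closed_csubspace (P i)"
      unfolding P_def
      by (intro closed_csubspace_orth_plus cEK closed_csubspace_Int[OF cK closed_csubspace_orth_compl])
  qed
  have NE: "N i \<subseteq> E j \<inter> K" if d: "distinct3 i j k" for i j k
    using N(5)[OF d] IK[OF d] I[OF d] by blast
  have NP: "N i \<subseteq> P j" if d: "distinct3 i j k" for i j k
    using NE[OF d] P(4)[OF distinct3_swap[OF d]] by blast
  have PK: "P i \<subseteq> K" if d: "distinct3 i j k" for i j k
    using P(2)[OF d] set_plus_upper(2)[OF closed_csubspace_subspace[OF N(1)[OF d]]] by blast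
  have cP0: "closed_csubspace P0"
    unfolding P0_def by (intro closed_csubspace_Int P(1)) (rule distinct3_instances)+
  have cS: "closed_csubspace S"
    unfolding S_def by (intro closed_csubspace_Int E) auto
  have SE: "S \<subseteq> E i \<inter> K" if d: "distinct3 i j k" for i j k
    using IES[OF d] by blast
  have SP0: "S \<subseteq> P0"
    unfolding P0_def using SE P(4) distinct3_instances by blast
  have cQ: "closed_csubspace Q"
    unfolding Q_def by (intro closed_csubspace_Int cP0 closed_csubspace_orth_compl)
  have SQ: "S + Q = P0"
    unfolding Q_def by (rule relative_orth_complement[OF cS closed_csubspace_subspace[OF cP0] SP0])

  note d1 = distinct3_instances(1) and d2 = distinct3_instances(2) and d3 = distinct3_instances(3)
    and d4 = distinct3_instances(4)
  note sub = closed_csubspace_subspace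
  have N3: "N 3 + P0 = P 1 \<inter> P 2"
    unfolding P0_def
    by (rule summand_split[OF sub[OF N(1)[OF d3]] sub[OF closed_csubspace_Int[OF P(1)[OF d1] P(1)[OF d2]]]])
       (use P(2)[OF d3] PK[OF d1] NP[OF d3] NP[OF d4] in auto)
  have N2: "N 2 + P 1 \<inter> P 2 = P 1"
    by (rule summand_split[OF sub[OF N(1)[OF d2]] sub[OF P(1)[OF d1]]])
       (use P(2)[OF d2] PK[OF d1] NP[OF d2] in auto)
  have M3: "M 3 + K = R 1 \<inter> R 2"
    unfolding K_def
    by (rule summand_split[OF sub[OF M(1)[OF d3]] sub[OF closed_csubspace_Int[OF cR cR]]])
       (use M(4)[OF d3] M(4)[OF d1] set_plus_upper(2)[OF sub[OF M(1)[OF d1]]] MR[OF d3] MR[OF d4] in auto)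
  have M2: "M 2 + R 1 \<inter> R 2 = R 1"
    by (rule summand_split[OF sub[OF M(1)[OF d2]] sub[OF cR]])
       (use M(4)[OF d2] M(4)[OF d1] set_plus_upper(2)[OF sub[OF M(1)[OF d1]]] MR[OF d2] in auto)
  note sums = SQ N3 N2 P(2)[OF d1] M3 M2 M(4)[OF d1]
    plus_orth_compl[OF cJ, unfolded add.commute[of J]]
  have zero: "0 \<in> R 1 \<inter> R 2" "0 \<in> K" "0 \<in> P 1" "0 \<in> P 1 \<inter> P 2" "0 \<in> P0" "0 \<in> Q" "0 \<in> S"
    using cR[of 1] cR[of 2] cK P(1)[OF d1] P(1)[OF d2] cP0 cQ cS
    by (auto intro!: complex_vector.subspace_0 sub)
  have disjoint: "orth_compl J \<inter> J = {0}" "M 1 \<inter> R 1 = {0}" "M 2 \<inter> (R 1 \<inter> R 2) = {0}"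
      "M 3 \<inter> K = {0}" "N 1 \<inter> P 1 = {0}" "N 2 \<inter> (P 1 \<inter> P 2) = {0}" "N 3 \<inter> P0 = {0}"
      "S \<inter> Q = {0}"
  proof -
    have smaller: "A \<inter> B' = {0}" if "A \<inter> B = {0}" "B' \<subseteq> B" "0 \<in> B'" for A B B' :: "'a set"
      using that by blast
    show "orth_compl J \<inter> J = {0}" using inter_orth_compl[OF sub[OF cJ]] by blast
    show "M 1 \<inter> R 1 = {0}" "N 1 \<inter> P 1 = {0}" by (rule M(3)[OF d1], rule P(3)[OF d1])
    show "M 2 \<inter> (R 1 \<inter> R 2) = {0}" by (rule smaller[OF M(3)[OF d2] _ zero(1)]) blast
    show "M 3 \<inter> K = {0}" by (rule smaller[OF M(3)[OF d3] _ zero(2)]) (simp add: K_def)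
    show "N 2 \<inter> (P 1 \<inter> P 2) = {0}" by (rule smaller[OF P(3)[OF d2] _ zero(4)]) blast
    show "N 3 \<inter> P0 = {0}" by (rule smaller[OF P(3)[OF d3] _ zero(5)]) (simp add: P0_def)
    show "S \<inter> Q = {0}"
      by (rule smaller[OF inter_orth_compl[OF sub[OF cS]] _ zero(6)]) (simp add: Q_def)
  qed
  have direct: "top_direct [orth_compl J, M 1, M 2, M 3, N 1, N 2, N 3, S, Q]"
    unfolding top_direct.simps sum_list.Cons sum_list.Nil add_0_right sums disjoint
    by (intro conjI TrueI refl closed_csubspace_orth_compl closed_csubspace_Int cJ cR cK cP0 cQ cS
        M(1)[OF d1] M(1)[OF d2] M(1)[OF d3] N(1)[OF d1] N(1)[OF d2] N(1)[OF d3] P(1)[OF d1] P(1)[OF d2])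
       (use closed_csubspace_orth_compl[of "{0}"] zero(6) in \<open>auto simp: orth_compl_zero set_zero\<close>)
  have total: "sum_list [orth_compl J, M 1, M 2, M 3, N 1, N 2, N 3, S, Q] = UNIV"
    by (simp only: sum_list.Cons sum_list.Nil add_0_right sums)
  have decomposition: "E i = S + (N j + (N k + (M i + (E i \<inter> Q))))" if d: "distinct3 i j k" for i j k
  proof -
    have s: "complex_vector.subspace (E i \<inter> K)" "complex_vector.subspace (E i \<inter> K \<inter> P j)"
      "complex_vector.subspace (E i \<inter> P0)"
      using cE[OF d] cK P(1)[OF distinct3_swap[OF d]] cP0 by (auto intro!: closed_csubspace_Int sub)
    have j: "N j + E i \<inter> K \<inter> P j = E i \<inter> K"
      by (rule summand_split[OF sub[OF N(1)[OF distinct3_swap[OF d]]] s(1)])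
         (use NE[OF distinct3_swap[OF d]] P(2)[OF distinct3_swap[OF d]] in auto)
    have d': "distinct3 k i j" using d unfolding distinct3_def by auto
    have d'': "distinct3 k j i" using d unfolding distinct3_def by auto
    have k: "N k + E i \<inter> K \<inter> P j \<inter> P k = E i \<inter> K \<inter> P j"
      by (rule summand_split[OF sub[OF N(1)[OF d']] s(2)])
         (use NE[OF d'] NP[OF d''] P(2)[OF d'] in auto)
    have "E i \<inter> K \<inter> P j \<inter> P k = E i \<inter> P0"
      using Pall_eq[OF d] P(4)[OF d] PK[OF d] by blast
    also have "\<dots> = S + E i \<inter> P0 \<inter> orth_compl S"
      using SE[OF d] SP0 by (intro relative_orth_complement[symmetric] cS s(3)) auto
    also have "E i \<inter> P0 \<inter> orth_compl S = E i \<inter> Q"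
      unfolding Q_def by blast
    finally have "E i \<inter> K = N j + (N k + (S + E i \<inter> Q))" using j k by simp
    then show ?thesis using M(2)[OF d] by (simp add: ac_simps)
  qed
  have meet: "E i \<inter> E j \<inter> Q = {0}" if d: "distinct3 i j k" for i j k
  proof -
    have d': "distinct3 k i j" using d unfolding distinct3_def by auto
    \<comment> \<open>Any vector of \<open>E i \<inter> E j = S + N k\<close> lying in \<open>P k\<close> belongs to \<open>S\<close>, as \<open>N k\<close> meets \<open>P k\<close> in zero.\<close>
    have "E i \<inter> E j \<inter> P0 \<subseteq> (S + N k) \<inter> P k"
      using N(2)[OF d'] I[OF d'] Pall_eq[OF d] by blast
    also have "\<dots> = S + N k \<inter> P k"
      using SE[OF d'] P(4)[OF d'] by (intro modular_law sub[OF cS] sub[OF P(1)[OF d']]) blast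
    also have "\<dots> = S" using P(3)[OF d'] by simp
    finally have "E i \<inter> E j \<inter> Q \<subseteq> S \<inter> orth_compl S" unfolding Q_def by blast
    moreover have "0 \<in> E i \<inter> E j \<inter> Q"
      using cE[OF d] cQ by (simp add: complex_vector.subspace_0 sub)
    ultimately show ?thesis
      using inter_orth_compl[OF sub[OF cS]] by blast
  qed
  have join: "Q \<subseteq> E i \<or>\<^sub>H E j" if d: "distinct3 i j k" for i j k
  proof -
    have d': "distinct3 k i j" using d unfolding distinct3_def by auto
    have "Q \<subseteq> P k" "P k \<subseteq> K" "K \<subseteq> R k"
      using Pall_eq[OF d'] PK[OF d'] Kall[OF d'] unfolding Q_def by auto
    then show ?thesis using R[OF d'] by simp
  qed
  have "brenner_summands E (orth_compl J) M N S Q"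
    unfolding brenner_summands_def
    by (intro conjI allI impI direct total) (rule decomposition meet join; assumption)+
  then show ?thesis by blast
qed


section \<open>Systems that split along orthogonal summands\<close>

lemma corthogonal_sets_sum_list:
  assumes "\<And>Y. Y \<in> set Ys \<Longrightarrow> corthogonal_sets X Y"
  shows "corthogonal_sets X (sum_list Ys)"
  using assms
proof (induction Ys)
  case Nil
  then show ?case by (simp add: corthogonal_sets_def set_zero)
qed (simp add: corthogonal_sets_plus_right)

lemma closed_csubspace_orth_sum_list:
  fixes Xs :: "'a::complex_hilbert set list"
  assumes "sorted_wrt corthogonal_sets Xs" "\<And>X. X \<in> set Xs \<Longrightarrow> closed_csubspace X"
  shows "closed_csubspace (sum_list Xs)"
  using assms
  by (induction Xs)
     (simp_all add: set_zero closed_csubspace_zero closed_csubspace_orth_plus corthogonal_sets_sum_list)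

lemma corthogonal_sets_plus_left:
  "corthogonal_sets A C \<Longrightarrow> corthogonal_sets B C \<Longrightarrow> corthogonal_sets (A + B) C"
  unfolding corthogonal_sets_commute[of _ C] by (rule corthogonal_sets_plus_right)

lemma corthogonal_sets_mono:
  "corthogonal_sets X Y \<Longrightarrow> X' \<subseteq> X \<Longrightarrow> Y' \<subseteq> Y \<Longrightarrow> corthogonal_sets X' Y'"
  unfolding corthogonal_sets_def by blast

text \<open>
  Components with respect to orthogonal subspaces are unique.
\<close>

lemma orth_plus_inter:
  fixes A A' B B' X Y :: "'a::complex_hilbert set"
  assumes X: "complex_vector.subspace X" and Y: "complex_vector.subspace Y" 
    and orth: "corthogonal_sets X Y" 
    and sub: "A \<subseteq> X" "A' \<subseteq> X" "B \<subseteq> Y" "B' \<subseteq> Y"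
  shows "(A + B) \<inter> (A' + B') = A \<inter> A' + B \<inter> B'"
proof
  show "(A + B) \<inter> (A' + B') \<subseteq> A \<inter> A' + B \<inter> B'"
  proof
    fix x assume "x \<in> (A + B) \<inter> (A' + B')"
    then obtain a b a' b' where x: "a \<in> A" "b \<in> B" "x = a + b" "a' \<in> A'" "b' \<in> B'" "x = a' + b'"
      by (auto elim!: in_set_plusE)
    then have "a - a' = b' - b" by (simp add: algebra_simps)
    moreover have "a - a' \<in> X" "b' - b \<in> Y"
      using x sub complex_vector.subspace_diff[OF X] complex_vector.subspace_diff[OF Y] by blast+
    ultimately have "a - a' \<in> X \<inter> Y" "b' - b \<in> X \<inter> Y" by auto
    then have "a = a'" "b = b'"
      unfolding corthogonal_sets_inter[OF X Y orth] by simp_all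
    then show "x \<in> A \<inter> A' + B \<inter> B'" using x by auto
  qed
  show "A \<inter> A' + B \<inter> B' \<subseteq> (A + B) \<inter> (A' + B')"
    by (intro Int_greatest set_plus_mono2) auto
qed

text \<open>
  The right-hand side is closed as an orthogonal sum of closed subspaces.
\<close>

lemma closure_orth_plus:
  fixes X Y Z :: "'a::complex_hilbert set"
  assumes X: "closed_csubspace X" and Y: "closed_csubspace Y" and orth: "corthogonal_sets X Y"
    and Z: "complex_vector.subspace Z" "Z \<subseteq> Y"
  shows "closure (X + Z) = X + closure Z"
proof
  have cZ: "closed_csubspace (closure Z)" and "closure Z \<subseteq> Y"
    using csubspace_closure[OF Z(1)] Z Y closure_minimal unfolding closed_csubspace_def by auto
  then have "closed_csubspace (X + closure Z)"
    using corthogonal_sets_mono[OF orth] by (intro closed_csubspace_orth_plus X) auto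
  then show "closure (X + Z) \<subseteq> X + closure Z"
    unfolding closed_csubspace_def
    by (intro closure_minimal set_plus_mono2 closure_subset) auto
  show "X + closure Z \<subseteq> closure (X + Z)"
  proof (rule set_plus_least)
    have sX: "complex_vector.subspace X" using X by (rule closed_csubspace_subspace)
    show "complex_vector.subspace (closure (X + Z))"
      by (intro csubspace_closure csubspace_set_plus sX Z)
    show "X \<subseteq> closure (X + Z)"
      using set_plus_upper(1)[OF Z(1), of X] closure_subset[of "X + Z"] by blast
    show "closure Z \<subseteq> closure (X + Z)"
      by (intro closure_mono set_plus_upper(2) sX)
  qed
qed

text \<open>
  The orthogonal picture common to both directions. The joins and meets of the \<open>Qs i\<close> enter as
  hypotheses of single lemmas, because one direction has to establish that the joins are \<open>Q\<close>.
\<close>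

locale orthogonal_blocks =
  fixes S :: "'a::complex_hilbert set" and N M :: "nat \<Rightarrow> 'a set" and Q :: "'a set"
    and Qs F :: "nat \<Rightarrow> 'a set"
  assumes closed_blocks: "closed_csubspace S" "closed_csubspace Q"
      "\<And>i. i \<in> {1,2,3} \<Longrightarrow> closed_csubspace (N i)" "\<And>i. i \<in> {1,2,3} \<Longrightarrow> closed_csubspace (M i)"
      "\<And>i. i \<in> {1,2,3} \<Longrightarrow> closed_csubspace (Qs i)"
    and Qs_subset: "\<And>i. i \<in> {1,2,3} \<Longrightarrow> Qs i \<subseteq> Q"
    and orth: "sorted_wrt corthogonal_sets [S, N 1, N 2, N 3, M 1, M 2, M 3, Q]"
    and F: "\<And>i j k. distinct3 i j k \<Longrightarrow> F i = sum_list [S, N j, N k, M i, Qs i]"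
begin

context
  fixes i j k assumes d: "distinct3 i j k"
begin

lemma closed_at:
  "X \<in> {S, N i, N j, N k, M i, M j, M k, Q, Qs i, Qs j, Qs k} \<Longrightarrow> closed_csubspace X"
  using closed_blocks d unfolding distinct3_def by auto

lemma orth_at: "sorted_wrt corthogonal_sets [S, N i, N j, N k, M i, M j, M k, Q]"
  using orth distinct3_cases[OF d] by (auto simp: corthogonal_sets_commute)

lemma Qs_subset_at: "Qs i \<subseteq> Q" "Qs j \<subseteq> Q" "Qs k \<subseteq> Q"
  using Qs_subset d unfolding distinct3_def by auto

lemma F_at: "F i = sum_list [S, N j, N k, M i, Qs i]" "F j = sum_list [S, N i, N k, M j, Qs j]"
  "F k = sum_list [S, N i, N j, M k, Qs k]"
  by (rule F[OF d] F[OF distinct3_swap[OF d]] F[OF distinct3_rotate[OF distinct3_rotate[OF d]]])+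

lemma subspace_at:
  "X \<in> {S, N i, N j, N k, M i, M j, M k, Q, Qs i, Qs j, Qs k} \<Longrightarrow> complex_vector.subspace X"
  by (rule closed_csubspace_subspace) (rule closed_at)

lemma closed_sum_at:
  assumes "sorted_wrt corthogonal_sets Xs"
    "set Xs \<subseteq> {S, N i, N j, N k, M i, M j, M k, Q, Qs i, Qs j, Qs k}"
  shows "closed_csubspace (sum_list Xs)"
  using assms(1) closed_csubspace_orth_sum_list closed_at assms(2) by blast

lemma absorb_at:
  assumes "X \<in> {S, N i, N j, N k}"
  shows "X + X = X" "X + (X + Y) = X + Y"
proof -
  show "X + X = X" using assms by (intro set_plus_self subspace_at) auto
  then show "X + (X + Y) = X + Y" by (simp flip: add.assoc)
qed

lemma sum_eq: "F i + F j = sum_list [S, N i, N j, N k, M i, M j] + (Qs i + Qs j)"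
  unfolding F_at by (simp add: ac_simps absorb_at)

lemma closed_common: "closed_csubspace (sum_list [S, N i, N j, N k, M i, M j])"
  by (rule closed_sum_at) (use orth_at in auto)

lemma common_orth_Q: "corthogonal_sets (sum_list [S, N i, N j, N k, M i, M j]) Q"
  unfolding corthogonal_sets_commute[of _ Q]
  using orth_at by (intro corthogonal_sets_sum_list) (auto simp: corthogonal_sets_commute)

lemma join_eq: "F i \<or>\<^sub>H F j = sum_list [S, N i, N j, N k, M i, M j] + (Qs i \<or>\<^sub>H Qs j)"
  unfolding join_def sum_eq
proof (rule closure_orth_plus[OF closed_common _ common_orth_Q])
  show Q: "closed_csubspace Q" by (rule closed_at) simp
  show "complex_vector.subspace (Qs i + Qs j)"
    by (intro csubspace_set_plus closed_csubspace_subspace closed_at) auto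
  show "Qs i + Qs j \<subseteq> Q"
    by (intro set_plus_least closed_csubspace_subspace[OF Q] Qs_subset_at)
qed

lemma meet_eq: "F i \<inter> F j = S + N k + Qs i \<inter> Qs j"
proof -
  let ?U = "S + N k" and ?B = "N j + M i" and ?B' = "N i + M j"
  have s: "complex_vector.subspace ?U" "complex_vector.subspace ?B" "complex_vector.subspace ?B'"
    "complex_vector.subspace (?B + ?B')" "complex_vector.subspace Q" "complex_vector.subspace (?B + ?B' + Q)"
    by (intro csubspace_set_plus subspace_at; simp)+
  have o: "corthogonal_sets ?B ?B'" "corthogonal_sets (?B + ?B') Q" "corthogonal_sets ?U (?B + ?B' + Q)"
    using orth_at
    by (intro corthogonal_sets_plus_left corthogonal_sets_plus_right; auto simp: corthogonal_sets_commute)+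
  have B: "?B \<subseteq> ?B + ?B'" "?B' \<subseteq> ?B + ?B'" by (intro set_plus_upper s)+
  have "F i \<inter> F j = (?U + (?B + Qs i)) \<inter> (?U + (?B' + Qs j))"
    unfolding F_at by (simp add: ac_simps)
  also have "\<dots> = ?U + (?B + Qs i) \<inter> (?B' + Qs j)"
    using orth_plus_inter[OF s(1) s(6) o(3) order_refl order_refl
      set_plus_mono2[OF B(1) Qs_subset_at(1)] set_plus_mono2[OF B(2) Qs_subset_at(2)]] by simp
  also have "(?B + Qs i) \<inter> (?B' + Qs j) = ?B \<inter> ?B' + Qs i \<inter> Qs j"
    by (rule orth_plus_inter[OF s(4) s(5) o(2) B Qs_subset_at(1,2)])
  also have "?B \<inter> ?B' = {0}" by (rule corthogonal_sets_inter[OF s(2,3) o(1)])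
  finally show ?thesis by simp
qed

lemma closed_join_plus:
  assumes "Qs i \<or>\<^sub>H Qs j = Q" shows "closed ((F i \<or>\<^sub>H F j) + F k)"
proof -
  have sQ: "complex_vector.subspace Q" "complex_vector.subspace (Qs k)"
    by (intro subspace_at; simp)+
  have "(F i \<or>\<^sub>H F j) + F k = sum_list [S, N i, N j, N k, M i, M j, M k] + (Q + Qs k)"
    unfolding join_eq assms unfolding F_at by (simp add: ac_simps absorb_at)
  also have "Q + Qs k = Q"
    using set_plus_least[OF sQ(1) order_refl Qs_subset_at(3)] set_plus_upper(1)[OF sQ(2)] by blast
  also have "sum_list [S, N i, N j, N k, M i, M j, M k] + Q = sum_list [S, N i, N j, N k, M i, M j, M k, Q]"
    by (simp add: ac_simps)
  also have "closed_csubspace \<dots>"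
    by (rule closed_sum_at) (use orth_at in auto)
  finally show ?thesis by (simp add: closed_csubspace_def)
qed

lemma closed_meet_plus:
  assumes "Qs i \<inter> Qs j = {0}" shows "closed ((F i \<inter> F j) + F k)"
proof -
  have "(F i \<inter> F j) + F k = sum_list [S, N i, N j, N k, M k, Qs k]"
    unfolding meet_eq assms unfolding F_at by (simp add: ac_simps absorb_at)
  also have "closed_csubspace \<dots>"
    by (rule closed_sum_at)
       (use orth_at corthogonal_sets_mono[OF _ order_refl Qs_subset_at(3)] in auto)
  finally show ?thesis by (simp add: closed_csubspace_def)
qed

text \<open>
  The component in \<open>Q\<close> of the join of \<open>F i\<close> and \<open>F j\<close> is the join of \<open>Qs i\<close> and \<open>Qs j\<close>.
\<close>

lemma Q_le_join:
  assumes "Q \<subseteq> F i \<or>\<^sub>H F j" shows "Qs i \<or>\<^sub>H Qs j = Q"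
proof
  have c: "closed_csubspace (Qs i \<or>\<^sub>H Qs j)"
    by (intro join_closed_csubspace closed_at) auto
  have Q: "closed_csubspace Q" by (rule closed_at) simp
  show le: "Qs i \<or>\<^sub>H Qs j \<subseteq> Q" by (intro join_least Q Qs_subset_at)
  have "Q \<subseteq> (Qs i \<or>\<^sub>H Qs j + sum_list [S, N i, N j, N k, M i, M j]) \<inter> Q"
    using assms unfolding join_eq by (simp add: add.commute)
  also have "\<dots> = Qs i \<or>\<^sub>H Qs j + sum_list [S, N i, N j, N k, M i, M j] \<inter> Q"
    by (rule modular_law[OF closed_csubspace_subspace[OF c] closed_csubspace_subspace[OF Q] le])
  also have "\<dots> = Qs i \<or>\<^sub>H Qs j"
    using corthogonal_sets_inter[OF closed_csubspace_subspace[OF closed_common] closed_csubspace_subspace[OF Q] common_orth_Q]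
    by simp
  finally show "Q \<subseteq> Qs i \<or>\<^sub>H Qs j" .
qed

end

end

text \<open>
  If some \<open>Qs i\<close> is zero, its joins with the other two are those two subspaces themselves, so both
  equal \<open>Q\<close>; but their meet is zero. If some \<open>Qs i\<close> is \<open>Q\<close>, then its meets with the others are
  the others, which are therefore zero, and the first case applies. Hence degenerate triples occur only for \<open>Q = {0}\<close>.
\<close>

lemma double_triangle_or_zero:
  fixes Q :: "'a::complex_hilbert set"
  assumes Q: "closed_csubspace Q"
    and Qs: "\<And>i. i \<in> {1,2,3} \<Longrightarrow> closed_csubspace (Qs i) \<and> Qs i \<subseteq> Q"
    and pairs: "\<And>i j k. distinct3 i j k \<Longrightarrow> Qs i \<or>\<^sub>H Qs j = Q \<and> Qs i \<inter> Qs j = {0}"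
  shows "double_triangle Q Qs \<or> Q = {0}"
proof (cases "Q = {0}")
  case False
  have nonzero: "Qs i \<noteq> {0}" if d: "distinct3 i j k" for i j k
  proof
    assume zero: "Qs i = {0}"
    have others: "Qs l = Q" if l: "distinct3 i l m" for l m
    proof -
      have "closed (Qs l)" using Qs[of l] l unfolding distinct3_def closed_csubspace_def by auto
      then have "Qs i \<or>\<^sub>H Qs l = Qs l" unfolding join_def zero by simp
      then show ?thesis using pairs[OF l] by simp
    qed
    have "Qs j = Q" "Qs k = Q"
      using others[OF d] others[OF distinct3_swap[OF distinct3_rotate[OF distinct3_rotate[OF d]]]] by simp_all
    then show False using pairs[OF distinct3_rotate[OF d]] False by simp
  qed
  have proper: "Qs i \<noteq> Q" if d: "distinct3 i j k" for i j k
  proof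
    assume "Qs i = Q"
    moreover have "Qs j \<subseteq> Q" using Qs[of j] d unfolding distinct3_def by auto
    ultimately have "Qs j = {0}" using pairs[OF d] by blast
    then show False using nonzero[OF distinct3_swap[OF d]] by simp
  qed
  have third: "\<exists>k. distinct3 i j k" if "i \<in> {1,2,3}" "j \<in> {1,2,3}" "i \<noteq> j" for i j
    \<comment> \<open>The indices \<open>1, 2, 3\<close> add up to \<open>6\<close>.\<close>
    using that unfolding distinct3_def by (intro exI[of _ "6 - i - j"]) auto
  have "Qs i \<noteq> {0} \<and> Qs i \<noteq> Q" if i: "i \<in> {1,2,3}" for i
  proof -
    obtain j k where "distinct3 i j k" using i distinct3_instances by blast
    then show ?thesis using nonzero proper by simp
  qed
  moreover have "Qs i \<or>\<^sub>H Qs j = Q \<and> Qs i \<inter> Qs j = {0}"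
    if "i \<in> {1,2,3}" "j \<in> {1,2,3}" "i \<noteq> j" for i j
    using third[OF that] pairs by blast
  ultimately have "double_triangle Q Qs"
    unfolding double_triangle_def using Q Qs by (intro conjI ballI impI) simp_all
  then show ?thesis ..
qed simp


section \<open>Transport along linear homeomorphisms\<close>

context
  fixes \<phi> :: "'a::complex_hilbert \<Rightarrow> 'b::complex_hilbert"
  assumes homeo: "clinear_homeo \<phi>"
begin

lemma homeo_inj: "inj \<phi>" and homeo_bij: "bij \<phi>"
  using homeo unfolding clinear_homeo_def bij_def by auto

lemma homeo_add: "\<phi> (x + y) = \<phi> x + \<phi> y" and homeo_scaleC: "\<phi> (c *\<^sub>C x) = c *\<^sub>C \<phi> x"
  using homeo unfolding clinear_homeo_def bounded_clinear_iff by blast+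

lemma homeo_zero: "\<phi> 0 = 0"
  using homeo_add[of 0 0] by simp

lemma homeo_image_plus: "\<phi> ` (A + B) = \<phi> ` A + \<phi> ` B"
proof
  show "\<phi> ` (A + B) \<subseteq> \<phi> ` A + \<phi> ` B"
    by (auto elim!: in_set_plusE intro!: set_plus_intro simp: homeo_add)
  show "\<phi> ` A + \<phi> ` B \<subseteq> \<phi> ` (A + B)"
    by (auto elim!: in_set_plusE intro!: imageI set_plus_intro simp flip: homeo_add)
qed

lemma homeo_image_Int: "\<phi> ` (A \<inter> B) = \<phi> ` A \<inter> \<phi> ` B"
  using homeo_inj by (rule image_Int)

lemma homeo_closed_image_iff: "closed (\<phi> ` A) \<longleftrightarrow> closed A"
proof
  have b: "bounded_linear \<phi>" "bounded_linear (inv \<phi>)"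
    using homeo bounded_clinear_bounded_linear unfolding clinear_homeo_def by blast+
  show "closed A" if "closed (\<phi> ` A)"
    using closed_vimage[OF that linear_continuous_on[OF b(1)]] homeo_inj by (simp add: inj_vimage_image_eq)
  show "closed (\<phi> ` A)" if "closed A"
    using closed_vimage[OF that linear_continuous_on[OF b(2)]] homeo_bij
    by (metis bij_imp_bij_inv bij_vimage_eq_inv_image inv_inv_eq)
qed

lemma homeo_image_closure: "\<phi> ` closure A = closure (\<phi> ` A)"
proof
  have "bounded_linear \<phi>"
    using homeo bounded_clinear_bounded_linear unfolding clinear_homeo_def by blast
  then show "\<phi> ` closure A \<subseteq> closure (\<phi> ` A)"
    by (intro image_closure_subset linear_continuous_on closed_closure closure_subset)
  show "closure (\<phi> ` A) \<subseteq> \<phi> ` closure A"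
    by (intro closure_minimal image_mono closure_subset) (simp add: homeo_closed_image_iff)
qed

lemma homeo_image_join: "\<phi> ` (A \<or>\<^sub>H B) = \<phi> ` A \<or>\<^sub>H \<phi> ` B"
  unfolding join_def homeo_image_closure homeo_image_plus ..

lemma homeo_closed_csubspace_image:
  assumes "closed_csubspace A" shows "closed_csubspace (\<phi> ` A)"
  unfolding closed_csubspace_def homeo_closed_image_iff
proof
  have A: "complex_vector.subspace A" by (rule closed_csubspace_subspace[OF assms])
  show "closed A" using assms by (simp add: closed_csubspace_def)
  show "complex_vector.subspace (\<phi> ` A)"
  proof (rule complex_vector.subspaceI)
    show "0 \<in> \<phi> ` A" using complex_vector.subspace_0[OF A] homeo_zero by (metis imageI)
    show "x + y \<in> \<phi> ` A" if "x \<in> \<phi> ` A" "y \<in> \<phi> ` A" for x y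
      using that complex_vector.subspace_add[OF A] by (auto simp flip: homeo_add)
    show "c *\<^sub>C x \<in> \<phi> ` A" if "x \<in> \<phi> ` A" for c x
      using that complex_vector.subspace_scale[OF A] by (auto simp flip: homeo_scaleC)
  qed
qed

lemma homeo_image_sum_list: "\<phi> ` sum_list Xs = sum_list (map ((`) \<phi>) Xs)"
  by (induction Xs) (simp_all add: homeo_image_plus homeo_zero set_zero)

end


section \<open>Closed sums and Brenner type decompositions\<close>

text \<open>
  The orthogonalizing homeomorphism carries the system to one whose summands are orthogonal.
  The image of \<open>Q\<close> still lies in the pairwise joins, and comparing components in it shows that the
  joins of the images of \<open>E i \<inter> Q\<close> exhaust it.
\<close>

lemma brenner_decomposition_of_summands:
  fixes E :: "nat \<Rightarrow> 'a::complex_hilbert set"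
  assumes E: "three_system E" and summands: "brenner_summands E L M N S Q"
  shows "has_brenner_decomposition E"
proof -
  let ?Xs = "[L, M 1, M 2, M 3, N 1, N 2, N 3, S, Q]"
  note summands = summands[unfolded brenner_summands_def]
  note top = summands[THEN conjunct1] and total = summands[THEN conjunct2, THEN conjunct1]
    and rest = summands[THEN conjunct2, THEN conjunct2, rule_format]
  note dec = rest[THEN conjunct1] and meet = rest[THEN conjunct2, THEN conjunct1]
    and join = rest[THEN conjunct2, THEN conjunct2]
  obtain \<phi> :: "'a \<Rightarrow> 'a" where \<phi>: "clinear_homeo \<phi>" and sorted: "sorted_wrt corthogonal_sets (map ((`) \<phi>) ?Xs)"
    using orthogonalize_top_direct[OF top] by blast
  note img = homeo_image_plus[OF \<phi>] homeo_image_Int[OF \<phi>] homeo_image_join[OF \<phi>]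
  define F where "F i = \<phi> ` E i" for i
  define S' where "S' = \<phi> ` S"
  define N' where "N' i = \<phi> ` N i" for i
  define M' where "M' i = \<phi> ` M i" for i
  define Q' where "Q' = \<phi> ` Q"
  define L' where "L' = \<phi> ` L"
  define Qs where "Qs i = \<phi> ` (E i \<inter> Q)" for i
  have blocks: "closed_csubspace X" if "X \<in> set ?Xs" for X
    by (rule top_direct_member[OF top that])
  have E_closed: "closed_csubspace (E i)" if "i \<in> {1,2,3}" for i
    using E that unfolding three_system_def by blast
  have closed': "closed_csubspace S'" "closed_csubspace Q'" "closed_csubspace L'"
    "\<And>i. i \<in> {1,2,3} \<Longrightarrow> closed_csubspace (N' i)" "\<And>i. i \<in> {1,2,3} \<Longrightarrow> closed_csubspace (M' i)"
    "\<And>i. i \<in> {1,2,3} \<Longrightarrow> closed_csubspace (Qs i)" "\<And>i. i \<in> {1,2,3} \<Longrightarrow> closed_csubspace (F i)"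
    unfolding S'_def Q'_def L'_def N'_def M'_def Qs_def F_def
    by (intro homeo_closed_csubspace_image[OF \<phi>] closed_csubspace_Int E_closed blocks; auto)+
  have sorted': "sorted_wrt corthogonal_sets [S', N' 1, N' 2, N' 3, M' 1, M' 2, M' 3, Q', L']"
    using sorted unfolding S'_def Q'_def L'_def N'_def M'_def
    by (simp add: corthogonal_sets_commute)
  have Qs_sub: "Qs i \<subseteq> Q'" for i unfolding Qs_def Q'_def by blast
  have F: "F i = sum_list [S', N' j, N' k, M' i, Qs i]" if d: "distinct3 i j k" for i j k
    unfolding F_def by (subst dec[OF d]) (simp add: img S'_def N'_def M'_def Qs_def)
  interpret orthogonal_blocks S' N' M' Q' Qs F
  proof
    show "sorted_wrt corthogonal_sets [S', N' 1, N' 2, N' 3, M' 1, M' 2, M' 3, Q']"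
      using sorted' by simp
  qed (rule Qs_sub | fact closed' F)+
  have pairs: "Qs i \<or>\<^sub>H Qs j = Q' \<and> Qs i \<inter> Qs j = {0}" if d: "distinct3 i j k" for i j k
  proof
    have "Q' \<subseteq> F i \<or>\<^sub>H F j"
      using image_mono[OF join[OF d], of \<phi>] unfolding Q'_def F_def img .
    then show "Qs i \<or>\<^sub>H Qs j = Q'" by (rule Q_le_join[OF d])
    have "Qs i \<inter> Qs j = \<phi> ` (E i \<inter> E j \<inter> Q)" unfolding Qs_def img by blast
    then show "Qs i \<inter> Qs j = {0}" unfolding meet[OF d] by (simp add: homeo_zero[OF \<phi>])
  qed
  have F_system: "three_system F" unfolding three_system_def using closed'(7) by blast
  have iso: "isomorphic_systems E F"
    unfolding isomorphic_systems_def using \<phi> unfolding clinear_homeo_def F_def by blast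
  have triangle: "double_triangle Q' Qs \<or> Q' = {0}"
    using closed'(2,6) Qs_sub pairs by (intro double_triangle_or_zero) auto
  have total': "is_orth_dsum UNIV [S', N' 1, N' 2, N' 3, M' 1, M' 2, M' 3, Q', L']"
  proof -
    have "UNIV = \<phi> ` sum_list ?Xs"
      unfolding total using bij_is_surj[OF homeo_bij[OF \<phi>]] by simp
    also have "\<dots> = sum_list [S', N' 1, N' 2, N' 3, M' 1, M' 2, M' 3, Q', L']"
      unfolding homeo_image_sum_list[OF \<phi>] S'_def Q'_def L'_def N'_def M'_def
      by (simp add: ac_simps)
    finally show ?thesis unfolding is_orth_dsum_def using sorted' by blast
  qed
  have F_dsum: "is_orth_dsum (F i) [S', N' j, N' k, M' i, Qs i]" if d: "distinct3 i j k" for i j k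
    unfolding is_orth_dsum_def
    using F[OF d] orth_at[OF d] corthogonal_sets_mono[OF _ order_refl Qs_sub, of _ i] by simp
  have indexed: "\<forall>i\<in>{1,2,3}. closed_csubspace (N' i) \<and> closed_csubspace (M' i) \<and>
      closed_csubspace (Qs i) \<and> Qs i \<subseteq> Q'"
    by (intro ballI conjI closed' Qs_sub)
  show ?thesis
    unfolding has_brenner_decomposition_def
    by (rule exI[of _ F], intro conjI F_system iso, rule exI[of _ S'], rule exI[of _ N'],
        rule exI[of _ M'], rule exI[of _ Q'], rule exI[of _ L'], rule exI[of _ Qs],
        intro conjI closed'(1-3) indexed triangle total' F_dsum distinct3_instances)
qed

text \<open>
  Both a double triangle and the case \<open>Q = {0}\<close> give \<open>Qs i \<or>\<^sub>H Qs j = Q\<close> and \<open>Qs i \<inter> Qs j = {0}\<close>, which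
  is all that closedness of the sums depends on.
\<close>

lemma closed_sums_of_brenner_decomposition:
  fixes E :: "nat \<Rightarrow> 'a::complex_hilbert set"
  assumes "has_brenner_decomposition E" and d: "distinct3 i j k"
  shows "closed ((E i \<or>\<^sub>H E j) + E k) \<and> closed ((E i \<inter> E j) + E k)"
proof -
  obtain F :: "nat \<Rightarrow> 'a set" and S N M Q L Qs where iso: "isomorphic_systems E F"
    and closed: "closed_csubspace S" "closed_csubspace Q"
      "\<forall>i\<in>{1,2,3}. closed_csubspace (N i) \<and> closed_csubspace (M i) \<and> closed_csubspace (Qs i) \<and> Qs i \<subseteq> Q"
    and triangle: "double_triangle Q Qs \<or> Q = {0}"
    and total: "is_orth_dsum UNIV [S, N 1, N 2, N 3, M 1, M 2, M 3, Q, L]"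
    and F: "is_orth_dsum (F 1) [S, N 2, N 3, M 1, Qs 1]" "is_orth_dsum (F 2) [S, N 1, N 3, M 2, Qs 2]"
      "is_orth_dsum (F 3) [S, N 1, N 2, M 3, Qs 3]"
    using assms(1)[unfolded has_brenner_decomposition_def]
    by (elim exE conjE) (rule that; assumption)
  have blocks: "closed_csubspace (N i)" "closed_csubspace (M i)" "closed_csubspace (Qs i)" "Qs i \<subseteq> Q"
    if "i \<in> {1,2,3}" for i
    using closed(3) that by blast+
  obtain \<phi> where \<phi>: "clinear_homeo \<phi>" and image: "\<forall>i\<in>{1,2,3}. \<phi> ` E i = F i"
    using iso unfolding isomorphic_systems_def clinear_homeo_def by blast
  have F_eq: "F i = sum_list [S, N j, N k, M i, Qs i]" if "distinct3 i j k" for i j k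
    using distinct3_cases[OF that] F unfolding is_orth_dsum_def by (auto simp: ac_simps)
  interpret orthogonal_blocks S N M Q Qs F
  proof
    show "sorted_wrt corthogonal_sets [S, N 1, N 2, N 3, M 1, M 2, M 3, Q]"
      using total by (simp add: is_orth_dsum_def)
  qed (fact closed(1,2) blocks F_eq)+
  have "Qs i \<or>\<^sub>H Qs j = Q \<and> Qs i \<inter> Qs j = {0}"
    using triangle
  proof
    assume "double_triangle Q Qs"
    then show ?thesis using d unfolding double_triangle_def distinct3_def by blast
  next
    assume Q: "Q = {0}"
    have "0 \<in> Qs i" "0 \<in> Qs j"
      by (rule complex_vector.subspace_0[OF subspace_at[OF d]]; simp)+
    then have "Qs i = {0}" "Qs j = {0}" using Qs_subset_at[OF d] unfolding Q by blast+
    then show ?thesis unfolding join_def Q by simp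
  qed
  then have "closed ((F i \<or>\<^sub>H F j) + F k)" "closed ((F i \<inter> F j) + F k)"
    using closed_join_plus[OF d] closed_meet_plus[OF d] by auto
  moreover have "F i = \<phi> ` E i" "F j = \<phi> ` E j" "F k = \<phi> ` E k"
    using image d unfolding distinct3_def by auto
  ultimately show ?thesis
    by (simp add: homeo_closed_image_iff[OF \<phi>]
        flip: homeo_image_plus[OF \<phi>] homeo_image_join[OF \<phi>] homeo_image_Int[OF \<phi>])
qed

theorem theorem4p10:
  fixes E :: "nat \<Rightarrow> 'a::complex_hilbert set"
  assumes "three_system E"
  shows "(\<forall>i\<in>{1,2,3}. \<forall>j\<in>{1,2,3}. \<forall>k\<in>{1,2,3}. i \<noteq> j \<and> j \<noteq> k \<and> k \<noteq> i \<longrightarrow>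
            closed ((E i \<or>\<^sub>H E j) + E k) \<and> closed ((E i \<inter> E j) + E k))
         \<longleftrightarrow> has_brenner_decomposition E"
    (is "?sums \<longleftrightarrow> ?brenner")
proof
  assume ?sums
  then have "\<exists>L M N S Q. brenner_summands E L M N S Q"
    using assms unfolding three_system_def
    by (intro brenner_summands_exist) (auto simp: distinct3_def)
  then show ?brenner using brenner_decomposition_of_summands[OF assms] by blast
next
  assume ?brenner
  then show ?sums
    using closed_sums_of_brenner_decomposition unfolding distinct3_def by blast
qed

end
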